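(* There exists an $\tilde{\mathcal{A}}$-module structure on $V_{\mathcal{C}}$ such that $$\tilde{Y}(x)=Y(a,x)\Delta(x),\qquad \tilde{Y}^{*}(x)=Y(b,x)\Delta(x)^{-1}.$$ Furthermore, ${\bf 1}$ is a vacuum vector of $V_{\mathcal{C}}$ viewed as an $\tilde{\mathcal{A}}$-module.
   Context: All spaces are over $\mathbb{C}$; $\delta(z)=\sum_{n\in\mathbb{Z}}z^n$. $\tilde{\mathcal{A}}$ is the associative algebra with identity generated by $\tilde{Y}_n,\tilde{Y}_n^{*}$ ($n\in\mathbb{Z}$) subject to $$\tilde{Y}(z)\tilde{Y}(w)+e^{w-z}\tilde{Y}(w)\tilde{Y}(z)=0,\quad \tilde{Y}^{*}(z)\tilde{Y}^{*}(w)+e^{w-z}\tilde{Y}^{*}(w)\tilde{Y}^{*}(z)=0,$$ $$\tilde{Y}(z)\tilde{Y}^{*}(w)+e^{z-w}\tilde{Y}^{*}(w)\tilde{Y}(z)=w^{-1}\delta\left(\tfrac{z}{w}\right),$$ where $\tilde{Y}(z)=\sum_n\tilde{Y}_nz^{-n-1}$, $\tilde{Y}^{*}(z)=\sum_n\tilde{Y}_n^{*}z^{-n-1}$. The component relations involve infinite sums, so $\tilde{\mathcal{A}}$ is understood as a topological algebra: an $\tilde{\mathcal{A}}$-module is a vector space $W$ with operators $\tilde{Y}_n,\tilde{Y}_n^{*}\in\mathrm{End}(W)$ such that, applied to each vector of $W$, each component of these relations is a finite sum (automatic if $\tilde{Y}_nw=0=\tilde{Y}_n^*w$ for $n$ large,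 for every $w\in W$) and the relations hold. A nonzero vector $v$ of an $\tilde{\mathcal{A}}$-module is a vacuum vector if $\tilde{Y}_nv=0=\tilde{Y}_n^{*}v$ for $n\ge0$. $\mathcal{C}$ is the associative algebra with identity generated by $a_n,b_n$ ($n\in\mathbb{Z}$) subject to $a_ma_n+a_na_m=0$, $b_mb_n+b_nb_m=0$, $a_mb_n+b_na_m=\delta_{m+n+1,0}$. Let $J_+$ be the left ideal generated by $a_n,b_n$ for $n\ge0$, $V_{\mathcal{C}}=\mathcal{C}/J_+$, ${\bf 1}=1+J_+$, $a=a_{-1}{\bf 1}$, $b=b_{-1}{\bf 1}$. It is known that $V_{\mathcal{C}}$ has a unique vertex superalgebra structure with vacuum vector ${\bf 1}$ such that $Y(a,x)=\sum_na_nx^{-n-1}$ and $Y(b,x)=\sum_nb_nx^{-n-1}$. A pseudo-endomorphism of a vertex superalgebra $V$ is a linear map $\Delta(x):V\to V\otimes\mathbb{C}((x))$ with $\Delta(x){\bf 1}={\bf 1}$ and $\Delta(x)Y(u,z)v=Y(\Delta(x-z)u,z)\Delta(x)v$ for $u,v\in V$ (with $\Delta(x-z)$ expanded in nonnegative powers of $z$); it is identified with a $\mathbb{C}((x))$-linear endomorphism of $V\otimes\mathbb{C}((x))$, and is a pseudo-automorphism if this endomorphism is invertible. Here $\Delta(x)$ is the (unique) pseudo-automorphism of $V_{\mathcal{C}}$ such that $\Delta(x)a=a\otimes e^{-x/2}$ and $\Delta(x)b=b\otimes e^{x/2}$. The operators $Y(a,x),Y(b,x)$ are extended $\mathbb{C}((x))$-linearly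 to $V_{\mathcal{C}}\otimes\mathbb{C}((x))$. *)

theory Defs
  imports
    Complex_Main
    "HOL-Library.Poly_Mapping"
    "HOL-Library.Groups_Big_Fun"
    "HOL-Library.Z2"
    "HOL-Computational_Algebra.Formal_Laurent_Series"
begin

section \<open>The algebra \<open>\<C>\<close> and the space \<open>V\<^sub>\<C>\<close>\<close>

inductive_set two_sided_ideal :: "'r::{ring,monoid_mult} set \<Rightarrow> 'r set" for S where
  base: "x \<in> S \<Longrightarrow> x \<in> two_sided_ideal S"
| zero: "0 \<in> two_sided_ideal S"
| add: "x \<in> two_sided_ideal S \<Longrightarrow> y \<in> two_sided_ideal S \<Longrightarrow> x + y \<in> two_sided_ideal S"
| mult: "x \<in> two_sided_ideal S \<Longrightarrow> r * x * t \<in> two_sided_ideal S"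

inductive_set left_ideal :: "'r::{ring,monoid_mult} set \<Rightarrow> 'r set" for S where
  base: "x \<in> S \<Longrightarrow> x \<in> left_ideal S"
| zero: "0 \<in> left_ideal S"
| add: "x \<in> left_ideal S \<Longrightarrow> y \<in> left_ideal S \<Longrightarrow> x + y \<in> left_ideal S"
| mult: "x \<in> left_ideal S \<Longrightarrow> r * x \<in> left_ideal S"

lemma two_sided_ideal_left: "x \<in> two_sided_ideal S \<Longrightarrow> r * x \<in> two_sided_ideal S"
  using two_sided_ideal.mult[of x S r 1] by simp

lemma two_sided_ideal_right: "x \<in> two_sided_ideal S \<Longrightarrow> x * t \<in> two_sided_ideal S"
  using two_sided_ideal.mult[of x S 1 t] by simp

lemma two_sided_ideal_uminus: "x \<in> two_sided_ideal S \<Longrightarrow> - x \<in> two_sided_ideal S"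
  using two_sided_ideal_left[of x S "- 1"] by simp

lemma left_ideal_uminus: "x \<in> left_ideal S \<Longrightarrow> - x \<in> left_ideal S"
  using left_ideal.mult[of x S "- 1"] by simp

datatype generator = A int | B int

text \<open>
  The free monoid on the generators, written additively because \<^typ>\<open>'a \<Rightarrow>\<^sub>0 'b\<close> carries
  the convolution product of the monoid algebra for an additively written monoid \<^typ>\<open>'a\<close>.
\<close>

datatype word = Word "generator list"

instantiation word :: monoid_add
begin

definition zero_word :: word where "0 = Word []"

fun plus_word :: "word \<Rightarrow> word \<Rightarrow> word" where
  "Word u + Word v = Word (u @ v)"

instance
proof
  fix u v w :: word
  show "u + v + w = u + (v + w)" by (cases u; cases v; cases w) simp
  show "0 + u = u" by (cases u) (simp add: zero_word_def)
  show "u + 0 = u" by (cases u) (simp add: zero_word_def)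
qed

end

type_synonym free_alg = "word \<Rightarrow>\<^sub>0 complex"

definition free_gen :: "generator \<Rightarrow> free_alg" where
  "free_gen g = Poly_Mapping.single (Word [g]) 1"

definition free_scale :: "complex \<Rightarrow> free_alg \<Rightarrow> free_alg" where
  "free_scale c x = Poly_Mapping.single 0 c * x"

definition clifford_relators :: "free_alg set" where
  "clifford_relators =
     {free_gen (A m) * free_gen (A n) + free_gen (A n) * free_gen (A m) | m n. True} \<union>
     {free_gen (B m) * free_gen (B n) + free_gen (B n) * free_gen (B m) | m n. True} \<union>
     {free_gen (A m) * free_gen (B n) + free_gen (B n) * free_gen (A m)
        - (if m + n + 1 = 0 then 1 else 0) | m n. True}"

definition clifford_cong :: "free_alg \<Rightarrow> free_alg \<Rightarrow> bool" where
  "clifford_cong x y \<longleftrightarrow> x - y \<in> two_sided_ideal clifford_relators"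

lemma equivp_clifford_cong: "equivp clifford_cong"
proof (rule equivpI)
  show "reflp clifford_cong"
    by (auto simp: reflp_def clifford_cong_def intro: two_sided_ideal.zero)
  show "symp clifford_cong"
    by (auto simp: symp_def clifford_cong_def dest: two_sided_ideal_uminus)
  show "transp clifford_cong"
    by (auto simp: transp_def clifford_cong_def dest: two_sided_ideal.add)
qed

quotient_type clifford = free_alg / clifford_cong
  by (rule equivp_clifford_cong)

lemma clifford_cong_refl: "clifford_cong x x"
  using equivp_clifford_cong by (rule equivp_reflp)

text \<open>Not an instance of \<^class>\<open>ring_1\<close>, which would require \<open>0 \<noteq> 1\<close>.\<close>

instantiation clifford :: "{ring, monoid_mult}"
begin

lift_definition zero_clifford :: clifford is 0 .

lift_definition one_clifford :: clifford is 1 .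

lift_definition plus_clifford :: "clifford \<Rightarrow> clifford \<Rightarrow> clifford" is "(+)"
  unfolding clifford_cong_def by (simp only: add_diff_add two_sided_ideal.add)

lift_definition uminus_clifford :: "clifford \<Rightarrow> clifford" is "uminus"
  unfolding clifford_cong_def by (simp only: minus_diff_minus two_sided_ideal_uminus)

lift_definition minus_clifford :: "clifford \<Rightarrow> clifford \<Rightarrow> clifford" is "(-)"
proof -
  fix x x' y y' :: free_alg
  assume "clifford_cong x x'" "clifford_cong y y'"
  then have "(x - x') + - (y - y') \<in> two_sided_ideal clifford_relators"
    unfolding clifford_cong_def by (intro two_sided_ideal.add two_sided_ideal_uminus)
  then show "clifford_cong (x - y) (x' - y')"
    unfolding clifford_cong_def by (simp add: algebra_simps)
qed

lift_definition times_clifford :: "clifford \<Rightarrow> clifford \<Rightarrow> clifford" is "(*)"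
proof -
  fix x x' y y' :: free_alg
  assume "clifford_cong x x'" "clifford_cong y y'"
  then have "(x - x') * y + x' * (y - y') \<in> two_sided_ideal clifford_relators"
    unfolding clifford_cong_def
    by (intro two_sided_ideal.add two_sided_ideal_left two_sided_ideal_right)
  then show "clifford_cong (x * y) (x' * y')"
    unfolding clifford_cong_def by (simp add: algebra_simps)
qed

instance
proof
  fix x y z :: clifford
  show "x + y + z = x + (y + z)" by transfer (simp add: add.assoc clifford_cong_refl)
  show "x + y = y + x" by transfer (simp add: add.commute clifford_cong_refl)
  show "0 + x = x" by transfer (simp add: clifford_cong_refl)
  show "- x + x = 0" by transfer (simp add: clifford_cong_refl)
  show "x - y = x + - y" by transfer (simp add: clifford_cong_refl)
  show "x * y * z = x * (y * z)" by transfer (simp add: mult.assoc clifford_cong_refl)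
  show "(x + y) * z = x * z + y * z" by transfer (simp add: distrib_right clifford_cong_refl)
  show "x * (y + z) = x * y + x * z" by transfer (simp add: distrib_left clifford_cong_refl)
  show "1 * x = x" by transfer (simp add: clifford_cong_refl)
  show "x * 1 = x" by transfer (simp add: clifford_cong_refl)
qed

end

lift_definition clifford_scale :: "complex \<Rightarrow> clifford \<Rightarrow> clifford" is free_scale
  unfolding clifford_cong_def free_scale_def
  by (simp only: right_diff_distrib[symmetric] two_sided_ideal_left)

lift_definition clifford_gen :: "generator \<Rightarrow> clifford" is free_gen .

abbreviation gen_a :: "int \<Rightarrow> clifford" where "gen_a n \<equiv> clifford_gen (A n)"

abbreviation gen_b :: "int \<Rightarrow> clifford" where "gen_b n \<equiv> clifford_gen (B n)"

interpretation clifford: vector_space clifford_scale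
proof
  fix c d :: complex and x y :: clifford
  show "clifford_scale c (x + y) = clifford_scale c x + clifford_scale c y"
    by transfer (simp add: free_scale_def distrib_left clifford_cong_refl)
  show "clifford_scale (c + d) x = clifford_scale c x + clifford_scale d x"
    by transfer (simp add: free_scale_def single_add distrib_right clifford_cong_refl)
  show "clifford_scale c (clifford_scale d x) = clifford_scale (c * d) x"
    by transfer (simp add: free_scale_def mult.assoc[symmetric] mult_single clifford_cong_refl)
  show "clifford_scale 1 x = x"
    by transfer (simp add: free_scale_def clifford_cong_refl)
qed

lemma clifford_scale_mult: "clifford_scale c x = clifford_scale c 1 * x"
  by transfer (simp add: free_scale_def clifford_cong_refl)

lifting_forget clifford.lifting

definition J_plus :: "clifford set" where
  "J_plus = left_ideal ({gen_a n | n. n \<ge> 0} \<union> {gen_b n | n. n \<ge> 0})"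

definition vc_cong :: "clifford \<Rightarrow> clifford \<Rightarrow> bool" where
  "vc_cong x y \<longleftrightarrow> x - y \<in> J_plus"

lemma equivp_vc_cong: "equivp vc_cong"
proof (rule equivpI)
  show "reflp vc_cong"
    by (auto simp: reflp_def vc_cong_def J_plus_def intro: left_ideal.zero)
  show "symp vc_cong"
    by (auto simp: symp_def vc_cong_def J_plus_def dest: left_ideal_uminus)
  show "transp vc_cong"
    by (auto simp: transp_def vc_cong_def J_plus_def dest: left_ideal.add)
qed

lemma vc_cong_refl: "vc_cong x x"
  using equivp_vc_cong by (rule equivp_reflp)

quotient_type vc = clifford / vc_cong
  by (rule equivp_vc_cong)

instantiation vc :: ab_group_add
begin

lift_definition zero_vc :: vc is 0 .

lift_definition plus_vc :: "vc \<Rightarrow> vc \<Rightarrow> vc" is "(+)"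
  unfolding vc_cong_def J_plus_def by (simp only: add_diff_add left_ideal.add)

lift_definition uminus_vc :: "vc \<Rightarrow> vc" is "uminus"
  unfolding vc_cong_def J_plus_def by (simp only: minus_diff_minus left_ideal_uminus)

lift_definition minus_vc :: "vc \<Rightarrow> vc \<Rightarrow> vc" is "(-)"
proof -
  fix x x' y y' :: clifford
  assume "vc_cong x x'" "vc_cong y y'"
  then have "(x - x') + - (y - y') \<in> J_plus"
    unfolding vc_cong_def J_plus_def by (intro left_ideal.add left_ideal_uminus)
  then show "vc_cong (x - y) (x' - y')"
    unfolding vc_cong_def by (simp add: algebra_simps)
qed

instance
proof
  fix x y z :: vc
  show "x + y + z = x + (y + z)" by transfer (simp add: add.assoc vc_cong_refl)
  show "x + y = y + x" by transfer (simp add: add.commute vc_cong_refl)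
  show "0 + x = x" by transfer (simp add: vc_cong_refl)
  show "- x + x = 0" by transfer (simp add: vc_cong_refl)
  show "x - y = x + - y" by transfer (simp add: vc_cong_refl)
qed

end

lift_definition vc_scale :: "complex \<Rightarrow> vc \<Rightarrow> vc" is clifford_scale
proof -
  fix c :: complex and x y :: clifford
  assume "vc_cong x y"
  then have "clifford_scale c 1 * (x - y) \<in> J_plus"
    unfolding vc_cong_def J_plus_def by (rule left_ideal.mult)
  then show "vc_cong (clifford_scale c x) (clifford_scale c y)"
    unfolding vc_cong_def
    by (simp only: clifford_scale_mult[symmetric] clifford.scale_right_diff_distrib)
qed

interpretation vc: vector_space vc_scale
proof
  fix c d :: complex and x y :: vc
  show "vc_scale c (x + y) = vc_scale c x + vc_scale c y"
    by transfer (simp add: clifford.scale_right_distrib vc_cong_refl)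
  show "vc_scale (c + d) x = vc_scale c x + vc_scale d x"
    by transfer (simp add: clifford.scale_left_distrib vc_cong_refl)
  show "vc_scale c (vc_scale d x) = vc_scale (c * d) x"
    by transfer (simp add: vc_cong_refl)
  show "vc_scale 1 x = x"
    by transfer (simp add: vc_cong_refl)
qed

lift_definition vc_act :: "clifford \<Rightarrow> vc \<Rightarrow> vc" is "(*)"
proof -
  fix c x y :: clifford
  assume "vc_cong x y"
  then have "c * (x - y) \<in> J_plus"
    unfolding vc_cong_def J_plus_def by (rule left_ideal.mult)
  then show "vc_cong (c * x) (c * y)"
    unfolding vc_cong_def by (simp only: right_diff_distrib)
qed

lift_definition vc_one :: vc is 1 .

definition vc_a :: vc where "vc_a = vc_act (gen_a (-1)) vc_one"

definition vc_b :: vc where "vc_b = vc_act (gen_b (-1)) vc_one"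


section \<open>Vertex superalgebras\<close>

text \<open>
  \<open>s\<close> is the scalar multiplication of \<open>V\<close>, \<open>P 0\<close> and \<open>P 1\<close> are the even and odd parts,
  and \<open>Y u n v\<close> is \<open>u\<^sub>n v\<close>, where \<open>Y(u,x) = \<Sum>\<^sub>n u\<^sub>n x\<^bsup>-n-1\<^esup>\<close>.
  \<^const>\<open>Sum_any\<close> sums over the support; all supports below are finite, by truncation.

  The last conjunct is the coefficient of \<open>x\<^sub>0\<^bsup>-l-1\<^esup> x\<^sub>1\<^bsup>-m-1\<^esup> x\<^sub>2\<^bsup>-n-1\<^esup>\<close> in the Jacobi identity
  \<open>x\<^sub>0\<^bsup>-1\<^esup> \<delta>((x\<^sub>1 - x\<^sub>2)/x\<^sub>0) Y(u,x\<^sub>1) Y(v,x\<^sub>2)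
    - (-1)\<^bsup>|u||v|\<^esup> x\<^sub>0\<^bsup>-1\<^esup> \<delta>((x\<^sub>2 - x\<^sub>1)/(-x\<^sub>0)) Y(v,x\<^sub>2) Y(u,x\<^sub>1)
    = x\<^sub>2\<^bsup>-1\<^esup> \<delta>((x\<^sub>1 - x\<^sub>0)/x\<^sub>2) Y(Y(u,x\<^sub>0)v,x\<^sub>2)\<close>.
\<close>

definition vertex_superalgebra ::
  "(complex \<Rightarrow> 'v::ab_group_add \<Rightarrow> 'v) \<Rightarrow> (bit \<Rightarrow> 'v set) \<Rightarrow> 'v \<Rightarrow> ('v \<Rightarrow> int \<Rightarrow> 'v \<Rightarrow> 'v) \<Rightarrow> bool" where
  "vertex_superalgebra s P vac Y \<longleftrightarrow>
     vector_space s \<and>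
     (\<forall>p. module.subspace s (P p)) \<and>
     P 0 \<inter> P 1 = {0} \<and> (\<forall>v. \<exists>v0\<in>P 0. \<exists>v1\<in>P 1. v = v0 + v1) \<and>
     (\<forall>n v. Vector_Spaces.linear s s (\<lambda>u. Y u n v)) \<and>
     (\<forall>u n. Vector_Spaces.linear s s (Y u n)) \<and>
     (\<forall>p q. \<forall>u\<in>P p. \<forall>v\<in>P q. \<forall>n. Y u n v \<in> P (p + q)) \<and>
     (\<forall>u v. \<exists>N. \<forall>n\<ge>N. Y u n v = 0) \<and>
     vac \<in> P 0 \<and>
     (\<forall>n v. Y vac n v = (if n = -1 then v else 0)) \<and>
     (\<forall>v. Y v (-1) vac = v \<and> (\<forall>n\<ge>0. Y v n vac = 0)) \<and>
     (\<forall>p q. \<forall>u\<in>P p. \<forall>v\<in>P q. \<forall>w l m n.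
        Sum_any (\<lambda>i::nat. s ((-1) ^ i * (of_int l gchoose i))
           (Y u (m + l - int i) (Y v (n + int i) w)
             - s ((if p = 1 \<and> q = 1 then -1 else 1) * (-1) powi l)
                 (Y v (n + l - int i) (Y u (m + int i) w))))
        = Sum_any (\<lambda>i::nat. s (of_int m gchoose i) (Y (Y u (l + int i) v) (m + n - int i) w)))"


section \<open>Pseudo-automorphisms\<close>

text \<open>
  A formal series \<open>\<Sum>\<^sub>k U\<^sub>k x\<^sup>k\<close> with coefficients in \<open>V\<close> is a function \<open>U :: int \<Rightarrow> 'v\<close>, and
  \<open>V \<otimes> \<complex>((x))\<close> is identified with its image under the canonical injection into the space of
  such series.
\<close>

definition tensor :: "(complex \<Rightarrow> 'v \<Rightarrow> 'v) \<Rightarrow> 'v \<Rightarrow> complex fls \<Rightarrow> int \<Rightarrow> 'v" where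
  "tensor s v f = (\<lambda>k. s (fls_nth f k) v)"

definition tensor_space :: "(complex \<Rightarrow> 'v::ab_group_add \<Rightarrow> 'v) \<Rightarrow> (int \<Rightarrow> 'v) set" where
  "tensor_space s = {(\<lambda>k. \<Sum>i<r. tensor s (v i) (f i) k) | (r::nat) v f. True}"

text \<open>
  The \<open>\<complex>((x))\<close>-linear extension to \<open>V \<otimes> \<complex>((x))\<close> of a linear map
  \<open>v \<mapsto> \<Sum>\<^sub>k (F v k) x\<^sup>k\<close> defined on \<open>V\<close>, sending \<open>\<Sum>\<^sub>m U\<^sub>m x\<^sup>m\<close> to \<open>\<Sum>\<^sub>m F(U\<^sub>m) x\<^sup>m\<close>.
  The support of the sum is finite if \<open>U \<in> V \<otimes> \<complex>((x))\<close> and each \<open>F v\<close> is bounded below.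
\<close>

definition laurent_ext :: "('v \<Rightarrow> int \<Rightarrow> 'v) \<Rightarrow> (int \<Rightarrow> 'v) \<Rightarrow> int \<Rightarrow> 'v::ab_group_add" where
  "laurent_ext F U = (\<lambda>k. Sum_any (\<lambda>m. F (U m) (k - m)))"

text \<open>
  \<open>D v k\<close> is the coefficient of \<open>x\<^sup>k\<close> in \<open>\<Delta>(x)v\<close>. The last conjunct is the coefficient of
  \<open>x\<^sup>p z\<^bsup>-n-1\<^esup>\<close> in \<open>\<Delta>(x)Y(u,z)v = Y(\<Delta>(x-z)u,z)\<Delta>(x)v\<close>, using
  \<open>\<Delta>(x-z)u = \<Sum>\<^sub>k \<Sum>\<^sub>j (-1)\<^sup>j (k choose j) (D u k) x\<^bsup>k-j\<^esup> z\<^sup>j\<close> with \<open>j \<ge> 0\<close>.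
\<close>

definition pseudo_endomorphism ::
  "(complex \<Rightarrow> 'v::ab_group_add \<Rightarrow> 'v) \<Rightarrow> 'v \<Rightarrow> ('v \<Rightarrow> int \<Rightarrow> 'v \<Rightarrow> 'v) \<Rightarrow> ('v \<Rightarrow> int \<Rightarrow> 'v) \<Rightarrow> bool" where
  "pseudo_endomorphism s vac Y D \<longleftrightarrow>
     (\<forall>v. D v \<in> tensor_space s) \<and>
     (\<forall>k. Vector_Spaces.linear s s (\<lambda>v. D v k)) \<and>
     D vac = tensor s vac 1 \<and>
     (\<forall>u v n p. D (Y u n v) p =
        Sum_any (\<lambda>(k::int, j::nat). s ((-1) ^ j * (of_int k gchoose j))
          (Y (D u k) (n + int j) (D v (p - (k - int j))))))"

definition pseudo_automorphism ::
  "(complex \<Rightarrow> 'v::ab_group_add \<Rightarrow> 'v) \<Rightarrow> 'v \<Rightarrow> ('v \<Rightarrow> int \<Rightarrow> 'v \<Rightarrow> 'v) \<Rightarrow> ('v \<Rightarrow> int \<Rightarrow> 'v) \<Rightarrow> bool" where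
  "pseudo_automorphism s vac Y D \<longleftrightarrow>
     pseudo_endomorphism s vac Y D \<and> bij_betw (laurent_ext D) (tensor_space s) (tensor_space s)"

definition pseudo_inverse ::
  "(complex \<Rightarrow> 'v::ab_group_add \<Rightarrow> 'v) \<Rightarrow> ('v \<Rightarrow> int \<Rightarrow> 'v) \<Rightarrow> 'v \<Rightarrow> int \<Rightarrow> 'v" where
  "pseudo_inverse s D v = inv_into (tensor_space s) (laurent_ext D) (tensor s v 1)"


section \<open>Modules for \<open>\<A>\<close> tilde\<close>

text \<open>The series \<open>(\<Sum>\<^sub>n X\<^sub>n x\<^bsup>-n-1\<^esup>) v\<close>, as a function of the exponent of \<open>x\<close>.\<close>

definition field_series :: "(int \<Rightarrow> 'v \<Rightarrow> 'v) \<Rightarrow> 'v \<Rightarrow> int \<Rightarrow> 'v" where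
  "field_series X v = (\<lambda>k. X (- k - 1) v)"

text \<open>The coefficient of \<open>w\<^sup>i z\<^sup>j\<close> in \<open>e\<^bsup>\<epsilon>(w-z)\<^esup>\<close>.\<close>

definition exp_coeff :: "complex \<Rightarrow> nat \<Rightarrow> nat \<Rightarrow> complex" where
  "exp_coeff \<epsilon> i j = \<epsilon> ^ i * (- \<epsilon>) ^ j / (fact i * fact j)"

text \<open>
  The coefficients of \<open>z\<^bsup>-m-1\<^esup> w\<^bsup>-n-1\<^esup>\<close> in the relation
  \<open>X(z)Z(w) + e\<^bsup>\<epsilon>(w-z)\<^esup> Z(w)X(z) = c w\<^bsup>-1\<^esup> \<delta>(z/w)\<close>, applied to every vector.
\<close>

definition twisted_relation ::
  "(complex \<Rightarrow> 'v::ab_group_add \<Rightarrow> 'v) \<Rightarrow> complex \<Rightarrow> complex \<Rightarrow>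
     (int \<Rightarrow> 'v \<Rightarrow> 'v) \<Rightarrow> (int \<Rightarrow> 'v \<Rightarrow> 'v) \<Rightarrow> bool" where
  "twisted_relation s \<epsilon> c X Z \<longleftrightarrow>
     (\<forall>m n v.
        let t = (\<lambda>(i::nat, j::nat). s (exp_coeff \<epsilon> i j) (Z (n + int i) (X (m + int j) v)))
        in finite {ij. t ij \<noteq> 0} \<and>
           X m (Z n v) + Sum_any t = s (if m + n + 1 = 0 then c else 0) v)"

definition A_tilde_module ::
  "(complex \<Rightarrow> 'v::ab_group_add \<Rightarrow> 'v) \<Rightarrow> (int \<Rightarrow> 'v \<Rightarrow> 'v) \<Rightarrow> (int \<Rightarrow> 'v \<Rightarrow> 'v) \<Rightarrow> bool" where
  "A_tilde_module s Yt Ys \<longleftrightarrow>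
     vector_space s \<and>
     (\<forall>n. Vector_Spaces.linear s s (Yt n)) \<and> (\<forall>n. Vector_Spaces.linear s s (Ys n)) \<and>
     twisted_relation s 1 0 Yt Yt \<and>
     twisted_relation s 1 0 Ys Ys \<and>
     twisted_relation s (-1) 1 Yt Ys"

definition vacuum_vector :: "(int \<Rightarrow> 'v \<Rightarrow> 'v) \<Rightarrow> (int \<Rightarrow> 'v \<Rightarrow> 'v) \<Rightarrow> 'v::zero \<Rightarrow> bool" where
  "vacuum_vector Yt Ys v \<longleftrightarrow> v \<noteq> 0 \<and> (\<forall>n\<ge>0. Yt n v = 0 \<and> Ys n v = 0)"

end

theory Submission
  imports Defs "HOL-Library.Nat_Bijection"
begin

text \<open>
  Give \<open>a\<close> and \<open>b\<close> the weights \<open>\<omega> = -1/2\<close> and \<open>1/2\<close>. The space \<open>V\<^sub>\<C>\<close> is spanned by weight vectors, and on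
  weight \<open>\<lambda>\<close> one has \<open>\<Delta>(x) = e\<^bsup>\<lambda>x\<^esup> T\<close>, where \<open>T\<close> does not depend on \<open>x\<close>, preserves weights and satisfies
  \<open>T X(z) = e\<^bsup>-\<omega>z\<^esup> X(z) T\<close> for both generating fields \<open>X\<close>. Likewise \<open>\<Delta>(x)\<^bsup>-1\<^esup> = e\<^bsup>-\<lambda>x\<^esup> T\<^bsup>-1\<^esup>\<close>. Moving
  all copies of \<open>T\<^bsup>\<plusminus>1\<^esup>\<close> to the right turns both products in a defining relation into products of modes
  of fields \<open>e\<^bsup>cx\<^esup>X(x)\<close>, with the same exponents in either order, so that the relation follows from the
  Clifford anticommutators. That \<open>\<one>\<close> is nonzero is seen on an explicit Fock module.
\<close>

section \<open>Twisted modes\<close>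

definition dpow :: "complex \<Rightarrow> nat \<Rightarrow> complex" where
  "dpow c n = c ^ n / fact n"

lemma dpow_0_right [simp]: "dpow c 0 = 1"
  by (simp add: dpow_def)

lemma dpow_0_left: "dpow 0 n = (if n = 0 then 1 else 0)"
  by (simp add: dpow_def)

text \<open>The binomial theorem as e^(cx) e^(dx) = e^((c+d)x).\<close>

lemma dpow_add: "(\<Sum>i\<le>n. dpow c i * dpow d (n - i)) = dpow (c + d) n"
proof -
  have "dpow (c + d) n = (\<Sum>i\<le>n. of_nat (n choose i) * c ^ i * d ^ (n - i) / fact n)"
    by (simp add: dpow_def binomial_ring sum_divide_distrib)
  also have "\<dots> = (\<Sum>i\<le>n. dpow c i * dpow d (n - i))"
    by (rule sum.cong) (auto simp: dpow_def binomial_fact)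
  finally show ?thesis ..
qed

lemma exp_coeff_eq: "exp_coeff \<epsilon> i j = dpow \<epsilon> i * dpow (- \<epsilon>) j"
  by (simp add: exp_coeff_def dpow_def)

text \<open>Both sides are the coefficient of x^i z^j in e^(c(x-z)): once by expanding (x-z)^(i+j),
  the form used in \<open>pseudo_endomorphism\<close>, once as e^(cx) e^(-cz).\<close>

lemma dpow_binomial:
  "(- 1) ^ j * (of_nat (i + j) gchoose j) * dpow c (i + j) = dpow c i * dpow (- c) j"
proof -
  have "of_nat (i + j) gchoose j = (of_nat ((i + j) choose j) :: complex)"
    by (rule binomial_gbinomial[symmetric])
  then show ?thesis
    by (simp add: dpow_def binomial_fact power_add power_minus[of c] field_simps)
qed

lemma Sum_any_eq_sum:
  assumes "finite S" "\<And>x. x \<notin> S \<Longrightarrow> f x = 0"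
  shows "Sum_any f = sum f S"
  using assms by (intro Sum_any.expand_superset) auto

section \<open>Truncated fields and their multiplication by exponentials\<close>

locale complex_vector_space = vector_space s
  for s :: "complex \<Rightarrow> 'v::ab_group_add \<Rightarrow> 'v"
begin

abbreviation endo :: "('v \<Rightarrow> 'v) \<Rightarrow> bool" where
  "endo f \<equiv> Vector_Spaces.linear s s f"

lemma linear_addD: "endo f \<Longrightarrow> f (x + y) = f x + f y"
  by (simp add: Vector_Spaces.linear_iff)

lemma linear_scaleD: "endo f \<Longrightarrow> f (s c x) = s c (f x)"
  by (simp add: Vector_Spaces.linear_iff)

lemma linear_zeroD: "endo f \<Longrightarrow> f 0 = 0"
  using linear_scaleD[of f 0 0] by simp

lemma linear_sumD: "endo f \<Longrightarrow> f (sum g S) = (\<Sum>x\<in>S. f (g x))"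
  by (induction S rule: infinite_finite_induct) (auto simp: linear_addD linear_zeroD)

lemma linearI:
  assumes "\<And>x y. f (x + y) = f x + f y" "\<And>c x. f (s c x) = s c (f x)"
  shows "endo f"
  using assms vector_space_axioms by (simp add: Vector_Spaces.linear_iff)

definition truncated :: "(int \<Rightarrow> 'v \<Rightarrow> 'v) \<Rightarrow> bool" where
  "truncated X \<longleftrightarrow> (\<forall>v. \<exists>K. \<forall>n\<ge>K. X n v = 0)"

definition is_field :: "(int \<Rightarrow> 'v \<Rightarrow> 'v) \<Rightarrow> bool" where
  "is_field X \<longleftrightarrow> (\<forall>n. endo (X n)) \<and> truncated X"

text \<open>The modes of \<open>e\<^bsup>cx\<^esup>X(x)\<close>.\<close>

definition twist :: "complex \<Rightarrow> (int \<Rightarrow> 'v \<Rightarrow> 'v) \<Rightarrow> int \<Rightarrow> 'v \<Rightarrow> 'v" where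
  "twist c X n v = Sum_any (\<lambda>j::nat. s (dpow c j) (X (n + int j) v))"

lemma is_field_linear: "is_field X \<Longrightarrow> endo (X n)"
  by (simp add: is_field_def)

lemma is_field_truncated: "is_field X \<Longrightarrow> truncated X"
  by (simp add: is_field_def)

lemma truncatedD_nat:
  assumes "truncated X"
  obtains K :: nat where "\<And>j. j \<ge> K \<Longrightarrow> X (n + int j) v = 0"
proof -
  obtain N where "\<forall>m\<ge>N. X m v = 0"
    using assms by (auto simp: truncated_def)
  then show ?thesis by (intro that[of "nat (N - n)"]) auto
qed

lemma twist_eq_sum:
  assumes "\<And>j. j \<ge> K \<Longrightarrow> X (n + int j) v = 0"
  shows "twist c X n v = (\<Sum>j<K. s (dpow c j) (X (n + int j) v))"
  unfolding twist_def by (rule Sum_any_eq_sum) (auto simp: assms)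

lemma twist_0 [simp]: "twist 0 X = X"
proof (intro ext)
  fix n v
  show "twist 0 X n v = X n v"
    unfolding twist_def
    by (subst Sum_any_eq_sum[where S = "{0}"]) (auto simp: dpow_0_left)
qed

lemma twist_linear:
  assumes "is_field X"
  shows "endo (twist c X n)"
proof (rule linearI)
  fix x y
  obtain K L where K: "\<And>j. j \<ge> K \<Longrightarrow> X (n + int j) x = 0"
    and L: "\<And>j. j \<ge> L \<Longrightarrow> X (n + int j) y = 0"
    using is_field_truncated[OF assms] truncatedD_nat by meson
  have "twist c X n (x + y) = (\<Sum>j<max K L. s (dpow c j) (X (n + int j) (x + y)))"
    using K L is_field_linear[OF assms] by (intro twist_eq_sum) (auto simp: linear_addD)
  also have "\<dots> = (\<Sum>j<max K L. s (dpow c j) (X (n + int j) x)) + (\<Sum>j<max K L. s (dpow c j) (X (n + int j) y))"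
    by (simp add: linear_addD[OF is_field_linear[OF assms]] scale_right_distrib sum.distrib)
  also have "\<dots> = twist c X n x + twist c X n y"
    using K L by (subst (1 2) twist_eq_sum[of "max K L"]) auto
  finally show "twist c X n (x + y) = twist c X n x + twist c X n y" .
next
  fix r x
  obtain K where K: "\<And>j. j \<ge> K \<Longrightarrow> X (n + int j) x = 0"
    using is_field_truncated[OF assms] truncatedD_nat by meson
  note lin = is_field_linear[OF assms]
  have "twist c X n (s r x) = (\<Sum>j<K. s (dpow c j) (X (n + int j) (s r x)))"
    using K by (intro twist_eq_sum) (auto simp: linear_scaleD[OF lin])
  also have "\<dots> = s r (twist c X n x)"
    by (simp add: twist_eq_sum[of K X n x, OF K] linear_scaleD[OF lin] scale_sum_right mult.commute)
  finally show "twist c X n (s r x) = s r (twist c X n x)" .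
qed

lemma twist_truncated:
  assumes "truncated X"
  shows "truncated (twist c X)"
  unfolding truncated_def
proof
  fix v
  obtain K where "\<forall>n\<ge>K. X n v = 0"
    using assms by (auto simp: truncated_def)
  then have "twist c X n v = 0" if "n \<ge> K" for n
    using that twist_eq_sum[of 0 X n v c] by auto
  then show "\<exists>K. \<forall>n\<ge>K. twist c X n v = 0" by blast
qed

lemma twist_field: "is_field X \<Longrightarrow> is_field (twist c X)"
  by (simp add: is_field_def twist_truncated) (simp add: twist_linear is_field_def)

text \<open>Truncation cuts the double sum down to the triangle i + j < K, which
  \<open>dpow_add\<close> resums along the lines i + j = k.\<close>

lemma twist_twist:
  assumes "truncated X"
  shows "twist c (twist d X) = twist (c + d) X"
proof (intro ext)
  fix n v
  obtain K where K: "\<And>j. j \<ge> K \<Longrightarrow> X (n + int j) v = 0"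
    using assms truncatedD_nat by meson
  have inner: "twist d X (n + int i) v = (\<Sum>j<K-i. s (dpow d j) (X (n + int (i + j)) v))" for i
    using K by (subst twist_eq_sum[of "K - i"]) (auto simp: add.assoc simp flip: of_nat_add)
  have "twist c (twist d X) n v = (\<Sum>i<K. s (dpow c i) (twist d X (n + int i) v))"
    by (rule twist_eq_sum) (simp add: inner)
  also have "\<dots> = (\<Sum>i<K. \<Sum>j<K-i. s (dpow c i * dpow d j) (X (n + int (i + j)) v))"
    by (simp add: inner scale_sum_right)
  also have "\<dots> = (\<Sum>(i,j)\<in>{(i,j). i + j < K}. s (dpow c i * dpow d j) (X (n + int (i + j)) v))"
    by (subst sum.Sigma) (auto intro!: sum.cong)
  also have "\<dots> = (\<Sum>k<K. \<Sum>i\<le>k. s (dpow c i * dpow d (k - i)) (X (n + int k) v))"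
    by (subst sum.triangle_reindex) (auto intro!: sum.cong)
  also have "\<dots> = (\<Sum>k<K. s (dpow (c + d) k) (X (n + int k) v))"
    by (simp add: scale_sum_left[symmetric] dpow_add)
  also have "\<dots> = twist (c + d) X n v"
    by (rule twist_eq_sum[symmetric]) (rule K)
  finally show "twist c (twist d X) n v = twist (c + d) X n v" .
qed

text \<open>Only finitely many modes of \<open>Z\<close> survive on \<open>v\<close>, and each
  resulting vector has its own bound for \<open>X\<close>; the maximum serves both indices. All
  double sums over modes thereby become finite.\<close>

lemma truncated_pair:
  assumes X: "is_field X" and Z: "truncated Z"
  obtains K :: nat
  where "\<And>i j. i \<ge> K \<or> j \<ge> K \<Longrightarrow> X (m + int i) (Z (n + int j) v) = 0"
    and "\<And>j. j \<ge> K \<Longrightarrow> Z (n + int j) v = 0"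
proof -
  obtain J where J: "\<And>j. j \<ge> J \<Longrightarrow> Z (n + int j) v = 0"
    using Z truncatedD_nat by meson
  have "\<exists>I. \<forall>i\<ge>I. X (m + int i) (Z (n + int j) v) = 0" for j
    using truncatedD_nat[OF is_field_truncated[OF X]] by meson
  then obtain I where I: "\<And>i j. i \<ge> I j \<Longrightarrow> X (m + int i) (Z (n + int j) v) = 0"
    by metis
  define K where "K = Max (insert J (I ` {..<J}))"
  have "J \<le> K" and IK: "I j \<le> K" if "j < J" for j
    using that by (auto simp: K_def)
  then have "J \<le> K" by (simp add: K_def)
  show ?thesis
  proof (rule that[of K])
    fix i j
    assume ij: "i \<ge> K \<or> j \<ge> K"
    show "X (m + int i) (Z (n + int j) v) = 0"
    proof (cases "j < J")
      case True
      then show ?thesis using ij IK[OF True] \<open>J \<le> K\<close> by (intro I) auto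
    next
      case False
      then show ?thesis by (simp add: J linear_zeroD[OF is_field_linear[OF X]])
    qed
  qed (use J \<open>J \<le> K\<close> in auto)
qed

lemma twist_twist_eq_sum:
  assumes X: "is_field X"
    and K: "\<And>i j. i \<ge> K \<or> j \<ge> K \<Longrightarrow> X (m + int i) (Z (n + int j) v) = 0"
    and KZ: "\<And>j. j \<ge> K \<Longrightarrow> Z (n + int j) v = 0"
  shows "twist c X m (twist d Z n v)
    = (\<Sum>(i,j)\<in>{..<K} \<times> {..<K}. s (dpow c i * dpow d j) (X (m + int i) (Z (n + int j) v)))"
proof -
  note lin = is_field_linear[OF X]
  have "X (m + int i) (twist d Z n v) = (\<Sum>j<K. s (dpow d j) (X (m + int i) (Z (n + int j) v)))" for i
    by (simp add: twist_eq_sum[of K Z n v, OF KZ] linear_sumD[OF lin] linear_scaleD[OF lin])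
  then have "twist c X m (twist d Z n v)
      = (\<Sum>i<K. s (dpow c i) (\<Sum>j<K. s (dpow d j) (X (m + int i) (Z (n + int j) v))))"
    using K by (subst twist_eq_sum[of K]) auto
  then show ?thesis
    by (simp add: scale_sum_right sum.cartesian_product)
qed

text \<open>The bracket is a multiple of the delta function, on whose support z = w. There the
  factor e^(cz+dw) becomes e^((c+d)w), which is 1 if c + d = 0.\<close>

lemma twist_anticommute:
  assumes X: "is_field X" and Z: "is_field Z"
    and comm: "\<And>m n v. X m (Z n v) + Z n (X m v) = s (if m + n + 1 = 0 then \<kappa> else 0) v"
    and c: "\<kappa> = 0 \<or> c + d = 0"
  shows "twist c X m (twist d Z n v) + twist d Z n (twist c X m v)
    = s (if m + n + 1 = 0 then \<kappa> else 0) v"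
proof -
  obtain K1 where K1: "\<And>i j. i \<ge> K1 \<or> j \<ge> K1 \<Longrightarrow> X (m + int i) (Z (n + int j) v) = 0"
    "\<And>j. j \<ge> K1 \<Longrightarrow> Z (n + int j) v = 0"
    using truncated_pair[OF X is_field_truncated[OF Z]] by metis
  obtain K2 where K2: "\<And>i j. i \<ge> K2 \<or> j \<ge> K2 \<Longrightarrow> Z (n + int i) (X (m + int j) v) = 0"
    "\<And>j. j \<ge> K2 \<Longrightarrow> X (m + int j) v = 0"
    using truncated_pair[OF Z is_field_truncated[OF X]] by metis
  \<comment> \<open>\<open>K\<close> also exceeds -(m+n+1), the only value of i + j at which the
    bracket can be nonzero, so that this antidiagonal fits into the square.\<close>
  define K where "K = Max {K1, K2, nat (- (m + n + 1)) + 1}"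
  have K: "K1 \<le> K" "K2 \<le> K" "nat (- (m + n + 1)) < K"
    by (auto simp: K_def)
  let ?S = "{..<K} \<times> {..<K}"
  have "twist d Z n (twist c X m v)
      = (\<Sum>(j,i)\<in>?S. s (dpow d j * dpow c i) (Z (n + int j) (X (m + int i) v)))"
    by (intro twist_twist_eq_sum Z) (meson K(2) K2 le_trans)+
  also have "\<dots> = (\<Sum>(i,j)\<in>?S. s (dpow c i * dpow d j) (Z (n + int j) (X (m + int i) v)))"
    by (rule sum.reindex_bij_witness[of _ "\<lambda>(i,j). (j,i)" "\<lambda>(i,j). (j,i)"]) (auto simp: mult.commute)
  finally have ZX: "twist d Z n (twist c X m v) = \<dots>" .
  have XZ: "twist c X m (twist d Z n v)
      = (\<Sum>(i,j)\<in>?S. s (dpow c i * dpow d j) (X (m + int i) (Z (n + int j) v)))"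
    by (intro twist_twist_eq_sum X) (meson K(1) K1 le_trans)+
  have "twist c X m (twist d Z n v) + twist d Z n (twist c X m v)
      = (\<Sum>(i,j)\<in>?S. s (dpow c i * dpow d j)
           (X (m + int i) (Z (n + int j) v) + Z (n + int j) (X (m + int i) v)))"
    by (simp add: XZ ZX sum.distrib scale_right_distrib case_prod_unfold)
  also have "\<dots> = (\<Sum>(i,j)\<in>?S. s (dpow c i * dpow d j * (if m + n + 1 + int (i + j) = 0 then \<kappa> else 0)) v)"
    by (rule sum.cong) (auto simp: comm algebra_simps)
  also have "\<dots> = s (\<Sum>(i,j)\<in>?S. dpow c i * dpow d j * (if m + n + 1 + int (i + j) = 0 then \<kappa> else 0)) v"
    by (simp add: scale_sum_left case_prod_unfold)
  also have "(\<Sum>(i,j)\<in>?S. dpow c i * dpow d j * (if m + n + 1 + int (i + j) = 0 then \<kappa> else 0))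
      = (if m + n + 1 = 0 then \<kappa> else 0)"
  proof (cases "\<kappa> = 0 \<or> m + n + 1 > 0")
    case True
    then show ?thesis by (auto simp: case_prod_unfold intro!: sum.neutral)
  next
    case False
    define N where "N = nat (- (m + n + 1))"
    have "N < K"
      using K by (simp add: N_def)
    have N: "m + n + 1 + int k = 0 \<longleftrightarrow> k = N" for k
      using False by (auto simp: N_def)
    have "(\<Sum>(i,j)\<in>?S. dpow c i * dpow d j * (if m + n + 1 + int (i + j) = 0 then \<kappa> else 0))
        = (\<Sum>(i,j)\<in>?S. if i + j = N then \<kappa> * (dpow c i * dpow d j) else 0)"
      by (rule sum.cong) (auto simp del: of_nat_add simp: N)
    also have "\<dots> = (\<Sum>(i,j)\<in>{(i,j)\<in>?S. i + j = N}. \<kappa> * (dpow c i * dpow d j))"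
      by (rule sum.mono_neutral_cong_right) (auto split: if_splits)
    also have "\<dots> = (\<Sum>i\<le>N. \<kappa> * (dpow c i * dpow d (N - i)))"
      by (rule sum.reindex_bij_witness[of _ "\<lambda>i. (i, N - i)" fst])
        (use \<open>N < K\<close> in auto)
    also have "\<dots> = \<kappa> * dpow (c + d) N"
      by (simp add: sum_distrib_left[symmetric] dpow_add)
    \<comment> \<open>Here \<open>\<kappa>\<close> is nonzero, so c + d = 0 and only N = 0
      contributes.\<close>
    also have "\<dots> = (if m + n + 1 = 0 then \<kappa> else 0)"
      using c False N[of 0] by (auto simp: dpow_0_left)
    finally show ?thesis .
  qed
  finally show ?thesis .
qed

text \<open>A linear \<open>T\<close> commutes with multiplication by the scalar series e^(dz), all
  sums being finite.\<close>

lemma twist_intertwine: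
  assumes X: "is_field X" and T: "endo T"
    and TX: "\<And>n. T (X n v) = twist c X n (T v)"
  shows "T (twist d X n v) = twist (c + d) X n (T v)"
proof -
  note lin = is_field_linear[OF X]
  obtain K where K: "\<And>j. j \<ge> K \<Longrightarrow> X (n + int j) v = 0"
    using is_field_truncated[OF X] truncatedD_nat by meson
  have "T (twist d X n v) = (\<Sum>j<K. s (dpow d j) (twist c X (n + int j) (T v)))"
    by (simp add: twist_eq_sum[of K X n v, OF K] linear_sumD[OF T] linear_scaleD[OF T] TX)
  also have "\<dots> = twist d (twist c X) n (T v)"
    by (rule twist_eq_sum[symmetric]) (simp add: TX[symmetric] K linear_zeroD[OF T])
  finally show ?thesis
    by (simp add: twist_twist is_field_truncated X add.commute)
qed

text \<open>The factor e^(\<epsilon>(w-z)) splits into e^(\<epsilon>w) and e^(-\<epsilon>z), each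
  absorbed into the field in its own variable.\<close>

lemma twisted_relation_iff:
  assumes X: "is_field X" and Z: "is_field Z"
  shows "twisted_relation s \<epsilon> c X Z \<longleftrightarrow>
    (\<forall>m n v. X m (Z n v) + twist \<epsilon> Z n (twist (- \<epsilon>) X m v) = s (if m + n + 1 = 0 then c else 0) v)"
proof -
  have "finite {ij. t ij \<noteq> 0}" "Sum_any t = twist \<epsilon> Z n (twist (- \<epsilon>) X m v)"
    if t: "t = (\<lambda>(i::nat, j::nat). s (exp_coeff \<epsilon> i j) (Z (n + int i) (X (m + int j) v)))"
    for m n v t
  proof -
    obtain K where K: "\<And>i j. i \<ge> K \<or> j \<ge> K \<Longrightarrow> Z (n + int i) (X (m + int j) v) = 0"
      "\<And>j. j \<ge> K \<Longrightarrow> X (m + int j) v = 0"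
      using truncated_pair[OF Z is_field_truncated[OF X]] by metis
    have 0: "t ij = 0" if "ij \<notin> {..<K} \<times> {..<K}" for ij
      using that K by (cases ij) (auto simp: t not_less)
    show "finite {ij. t ij \<noteq> 0}"
      by (rule finite_subset[of _ "{..<K} \<times> {..<K}"]) (use 0 in blast, simp)
    show "Sum_any t = twist \<epsilon> Z n (twist (- \<epsilon>) X m v)"
    proof -
      have "Sum_any t = sum t ({..<K} \<times> {..<K})"
        using 0 by (intro Sum_any_eq_sum) auto
      then show ?thesis
        using K by (simp add: twist_twist_eq_sum[OF Z, of K] t exp_coeff_eq)
    qed
  qed
  then show ?thesis
    unfolding twisted_relation_def Let_def by presburger
qed

text \<open>The hypothesis, an identity of series in two variables, is multiplied by an exponential
  in each. It concerns a single pair \<open>v\<close>, \<open>u\<close> because \<open>p\<close> and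
  \<open>q\<close> will depend on the weight of \<open>v\<close>.\<close>

lemma twist_composition:
  assumes U: "is_field U" and V: "is_field V" and X: "is_field X" and Z: "is_field Z"
    and VU: "\<And>m n. V n (U m v) = twist p Z n (twist q X m u)"
  shows "twist c V n (twist d U m v) = twist (c + p) Z n (twist (d + q) X m u)"
proof -
  have V_outer: "twist c V n (U m' v) = twist (c + p) Z n (twist q X m' u)" for m'
    unfolding twist_twist[OF is_field_truncated[OF Z], symmetric]
    by (simp add: twist_def[of c] VU)
  obtain K1 where K1: "\<And>j. j \<ge> K1 \<Longrightarrow> U (m + int j) v = 0"
    using is_field_truncated[OF U] truncatedD_nat by meson
  obtain K2 where K2: "\<And>j. j \<ge> K2 \<Longrightarrow> twist q X (m + int j) u = 0"
    using is_field_truncated[OF twist_field[OF X]] truncatedD_nat by meson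
  note linV = twist_linear[OF V, of c n] and linZ = twist_linear[OF Z, of "c + p" n]
  have "twist d U m v = (\<Sum>j<max K1 K2. s (dpow d j) (U (m + int j) v))"
    using K1 by (intro twist_eq_sum) auto
  then have "twist c V n (twist d U m v)
      = (\<Sum>j<max K1 K2. s (dpow d j) (twist c V n (U (m + int j) v)))"
    by (simp add: linear_sumD[OF linV] linear_scaleD[OF linV])
  also have "\<dots> = twist (c + p) Z n (\<Sum>j<max K1 K2. s (dpow d j) (twist q X (m + int j) u))"
    by (simp add: V_outer linear_sumD[OF linZ] linear_scaleD[OF linZ])
  also have "(\<Sum>j<max K1 K2. s (dpow d j) (twist q X (m + int j) u)) = twist d (twist q X) m u"
    using K2 by (intro twist_eq_sum[symmetric]) auto
  finally show ?thesis
    by (simp add: twist_twist is_field_truncated X)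
qed

section \<open>Tensors with Laurent series and the extension of maps to them\<close>

lemma tensor_exp_nth:
  "tensor s v (fps_to_fls (fps_exp c)) k = (if k \<ge> 0 then s (dpow c (nat k)) v else 0)"
  by (simp add: tensor_def dpow_def)

lemma tensor_space_add_tensor:
  assumes "U \<in> tensor_space s"
  shows "(\<lambda>k. U k + tensor s v f k) \<in> tensor_space s"
proof -
  obtain r :: nat and w g where U: "U = (\<lambda>k. \<Sum>i<r. tensor s (w i) (g i) k)"
    using assms by (auto simp: tensor_space_def)
  have "(\<lambda>k. U k + tensor s v f k)
      = (\<lambda>k. \<Sum>i<Suc r. tensor s ((w(r := v)) i) ((g(r := f)) i) k)"
    by (auto simp: U intro!: ext)
  then show ?thesis
    unfolding tensor_space_def by blast
qed

lemma tensor_space_0: "(\<lambda>k. 0) \<in> tensor_space s"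
  by (auto simp: tensor_space_def intro!: exI[of _ "0::nat"])

lemma tensor_space_tensor: "tensor s v f \<in> tensor_space s"
  using tensor_space_add_tensor[OF tensor_space_0, of v f] by simp

lemma tensor_space_induct [consumes 1, case_names zero add]:
  assumes "U \<in> tensor_space s"
    and zero: "Q (\<lambda>k. 0)"
    and add: "\<And>U v f. U \<in> tensor_space s \<Longrightarrow> Q U \<Longrightarrow> Q (\<lambda>k. U k + tensor s v f k)"
  shows "Q U"
proof -
  have "Q (\<lambda>k. \<Sum>i<r. tensor s (v i) (f i) k)" for r :: nat and v f
  proof (induction r)
    case 0
    then show ?case using zero by simp
  next
    case (Suc r)
    have "(\<lambda>k. \<Sum>i<r. tensor s (v i) (f i) k) \<in> tensor_space s"
      unfolding tensor_space_def by blast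
    from add[OF this Suc] show ?case by simp
  qed
  then show ?thesis
    using assms(1) by (auto simp: tensor_space_def)
qed

lemma tensor_space_add:
  assumes "U \<in> tensor_space s" "W \<in> tensor_space s"
  shows "(\<lambda>k. U k + W k) \<in> tensor_space s"
  using assms(2)
proof (induction rule: tensor_space_induct)
  case zero
  then show ?case using assms(1) by simp
next
  case (add W v f)
  then show ?case
    using tensor_space_add_tensor[of "\<lambda>k. U k + W k" v f] by (simp add: add.assoc)
qed

lemma tensor_space_scale:
  assumes "U \<in> tensor_space s"
  shows "(\<lambda>k. s c (U k)) \<in> tensor_space s"
  using assms
proof (induction rule: tensor_space_induct)
  case zero
  then show ?case by (simp add: tensor_space_0)
next
  case (add U v f)
  have "(\<lambda>k. s c (U k + tensor s v f k)) = (\<lambda>k. s c (U k) + tensor s (s c v) f k)"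
    by (simp add: scale_right_distrib tensor_def mult.commute)
  then show ?case
    using tensor_space_add_tensor[OF add.IH] by simp
qed

lemma tensor_space_bounded_below:
  assumes "U \<in> tensor_space s"
  shows "\<exists>N. \<forall>k<N. U k = 0"
  using assms
proof (induction rule: tensor_space_induct)
  case (add U v f)
  then obtain N where "\<forall>k<N. U k = 0" by blast
  then have "\<forall>k<min N (fls_subdegree f). U k + tensor s v f k = 0"
    by (simp add: tensor_def)
  then show ?case by blast
qed simp

text \<open>For a pure tensor of \<open>v\<close> and \<open>f\<close>, the index \<open>m\<close>
  is bounded below because \<open>f\<close> is a Laurent series and above because \<open>D v\<close>
  is bounded below.\<close>

lemma laurent_ext_finite_support:
  assumes D: "\<And>k. endo (\<lambda>v. D v k)" "\<And>v. D v \<in> tensor_space s"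
    and U: "U \<in> tensor_space s"
  shows "finite {m. D (U m) (k - m) \<noteq> 0}"
  using U
proof (induction rule: tensor_space_induct)
  case zero
  then show ?case by (simp add: linear_zeroD[OF D(1)])
next
  case (add U v f)
  obtain N where N: "\<And>k. k < N \<Longrightarrow> D v k = 0"
    using tensor_space_bounded_below[OF D(2)] by blast
  have "{m. D (U m + tensor s v f m) (k - m) \<noteq> 0}
      \<subseteq> {m. D (U m) (k - m) \<noteq> 0} \<union> {fls_subdegree f..k - N}"
  proof
    fix m
    assume m: "m \<in> {m. D (U m + tensor s v f m) (k - m) \<noteq> 0}"
    have "fls_nth f m = 0" if "m < fls_subdegree f" using that by simp
    moreover have "D v (k - m) = 0" if "m > k - N" using that by (intro N) simp
    ultimately show "m \<in> {m. D (U m) (k - m) \<noteq> 0} \<union> {fls_subdegree f..k - N}"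
      using m by (auto simp: linear_addD[OF D(1)] linear_scaleD[OF D(1)] tensor_def not_le
        simp flip: not_less)
  qed
  then show ?case
    using add.IH finite_subset by blast
qed

lemma laurent_ext_add:
  assumes D: "\<And>k. endo (\<lambda>v. D v k)" "\<And>v. D v \<in> tensor_space s"
    and "U \<in> tensor_space s" "W \<in> tensor_space s"
  shows "laurent_ext D (\<lambda>k. U k + W k) = (\<lambda>k. laurent_ext D U k + laurent_ext D W k)"
  unfolding laurent_ext_def
  by (simp add: linear_addD[OF D(1)] Sum_any.distrib laurent_ext_finite_support assms)

lemma laurent_ext_scale:
  assumes D: "\<And>k. endo (\<lambda>v. D v k)" "\<And>v. D v \<in> tensor_space s"
    and U: "U \<in> tensor_space s"
  shows "laurent_ext D (\<lambda>k. s c (U k)) = (\<lambda>k. s c (laurent_ext D U k))"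
proof
  fix k
  let ?S = "{m. D (U m) (k - m) \<noteq> 0}"
  have fin: "finite ?S" by (rule laurent_ext_finite_support[OF assms])
  have "laurent_ext D (\<lambda>k. s c (U k)) k = (\<Sum>m\<in>?S. s c (D (U m) (k - m)))"
    unfolding laurent_ext_def linear_scaleD[OF D(1)] by (rule Sum_any_eq_sum) (use fin in auto)
  also have "\<dots> = s c (laurent_ext D U k)"
    unfolding laurent_ext_def by (simp add: scale_sum_right Sum_any.expand_set)
  finally show "laurent_ext D (\<lambda>k. s c (U k)) k = s c (laurent_ext D U k)" .
qed

end

text \<open>
  The vectors of weight \<open>\<lambda>\<close> are those on which a pseudo-endomorphism rescaling the generating
  fields \<open>X i\<close> by \<open>e\<^bsup>\<omega>(i)x\<^esup>\<close> acts by \<open>e\<^bsup>\<lambda>x\<^esup>\<close> times an operator independent of \<open>x\<close>.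
\<close>

locale weighted_module = complex_vector_space s
  for s :: "complex \<Rightarrow> 'v::ab_group_add \<Rightarrow> 'v" +
  fixes X :: "'i \<Rightarrow> int \<Rightarrow> 'v \<Rightarrow> 'v" and \<omega> :: "'i \<Rightarrow> complex" and vac :: 'v
  assumes X_field: "is_field (X i)"
    and cyclic: "\<lbrakk>subspace W; vac \<in> W; \<And>i n v. v \<in> W \<Longrightarrow> X i n v \<in> W\<rbrakk> \<Longrightarrow> W = UNIV"
begin

section \<open>Weight vectors in a module generated by fields\<close>

lemmas X_linear = is_field_linear[OF X_field]
lemmas X_truncated = is_field_truncated[OF X_field]

text \<open>Generated from \<open>vac\<close> rather than defined by eigenvalues, so that facts
  about weight vectors follow by induction on their construction. The vector 0 has every
  weight.\<close>

inductive weight :: "complex \<Rightarrow> 'v \<Rightarrow> bool" where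
  vac: "weight 0 vac"
| mode: "weight l v \<Longrightarrow> weight (l + \<omega> i) (X i n v)"
| zero: "weight l 0"
| add: "weight l v \<Longrightarrow> weight l w \<Longrightarrow> weight l (v + w)"
| scale: "weight l v \<Longrightarrow> weight l (s c v)"

lemma weight_sum: "(\<And>x. x \<in> S \<Longrightarrow> weight l (f x)) \<Longrightarrow> weight l (sum f S)"
  by (induction S rule: infinite_finite_induct) (auto intro: weight.zero weight.add)

lemma weight_twist:
  assumes "weight l v"
  shows "weight (l + \<omega> i) (twist c (X i) n v)"
proof -
  obtain K where K: "\<And>j. j \<ge> K \<Longrightarrow> X i (n + int j) v = 0"
    using X_truncated truncatedD_nat by meson
  show ?thesis
    by (subst twist_eq_sum[of K "X i" n v, OF K], assumption)
      (intro weight_sum weight.scale weight.mode assms)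
qed

text \<open>Finite sums of weight vectors form a subspace containing \<open>vac\<close> and stable
  under all modes, hence everything by \<open>cyclic\<close>. Additive claims reduce to weight
  vectors.\<close>

lemma weight_decompose_induct [case_names weight add]:
  assumes wt: "\<And>l v. weight l v \<Longrightarrow> Q v"
    and add: "\<And>x y. Q x \<Longrightarrow> Q y \<Longrightarrow> Q (x + y)"
  shows "Q v"
proof -
  let ?wts = "\<lambda>vs. \<forall>x\<in>set vs. \<exists>l. weight l x"
  define W where "W = {sum_list vs | vs. ?wts vs}"
  have W_I: "sum_list vs \<in> W" if "?wts vs" for vs
    using that by (auto simp: W_def)
  have W_map: "f (sum_list vs) \<in> W"
    if "?wts vs" and f: "endo f" "\<And>l x. weight l x \<Longrightarrow> \<exists>l'. weight l' (f x)" for vs f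
  proof -
    have "f (sum_list vs) = sum_list (map f vs)"
      by (induction vs) (auto simp: linear_zeroD[OF f(1)] linear_addD[OF f(1)])
    moreover have "?wts (map f vs)"
      using that(1) f(2) by simp blast
    ultimately show ?thesis using W_I by simp
  qed
  have "W = UNIV"
  proof (rule cyclic)
    show "subspace W"
    proof (rule subspaceI)
      show "0 \<in> W" using W_I[of "[]"] by simp
    next
      fix x y
      assume "x \<in> W" "y \<in> W"
      then obtain xs ys where "x = sum_list xs" "?wts xs" "y = sum_list ys" "?wts ys"
        by (auto simp: W_def)
      then show "x + y \<in> W" using W_I[of "xs @ ys"] by auto
    next
      fix c x
      assume "x \<in> W"
      then obtain xs where xs: "x = sum_list xs" "?wts xs"
        by (auto simp: W_def)
      have "endo (s c)"
        by (rule linearI) (simp_all add: scale_right_distrib mult.commute)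
      then show "s c x \<in> W"
        unfolding xs(1) by (rule W_map[OF xs(2)]) (blast intro: weight.scale)
    qed
    show "vac \<in> W" using W_I[of "[vac]"] weight.vac by auto
    show "X i n v \<in> W" if "v \<in> W" for i n v
    proof -
      obtain vs where vs: "v = sum_list vs" "?wts vs"
        using \<open>v \<in> W\<close> by (auto simp: W_def)
      show ?thesis
        unfolding vs(1) by (rule W_map[OF vs(2) X_linear]) (blast intro: weight.mode)
    qed
  qed
  then have "v \<in> W" by simp
  then obtain vs where "v = sum_list vs" "?wts vs" by (auto simp: W_def)
  then show ?thesis
  proof (induction vs arbitrary: v)
    case Nil
    then show ?case using wt[OF weight.zero] by simp
  next
    case (Cons x vs)
    then show ?case using wt add by fastforce
  qed
qed

text \<open>
  The map \<open>E v = \<Sum>\<^sub>k (E v k) x\<^sup>k\<close> satisfies \<open>E v = e\<^bsup>\<tau>\<lambda>x\<^esup> E\<^sub>0 v\<close> for \<open>v\<close> of weight \<open>\<lambda>\<close>, and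
  \<open>E\<^sub>0 X\<^sub>i(z) = e\<^bsup>-\<tau>\<omega>(i)z\<^esup> X\<^sub>i(z) E\<^sub>0\<close>. This covers \<open>\<Delta>(x)\<close> for \<open>\<tau> = 1\<close> and its inverse for \<open>\<tau> = -1\<close>.
\<close>

definition exponential :: "complex \<Rightarrow> ('v \<Rightarrow> int \<Rightarrow> 'v) \<Rightarrow> bool" where
  "exponential \<tau> E \<longleftrightarrow> (\<forall>k. endo (\<lambda>v. E v k)) \<and>
     (\<forall>l v. weight l v \<longrightarrow> weight l (E v 0) \<and>
        (\<forall>k. E v k = (if k \<ge> 0 then s (dpow (\<tau> * l) (nat k)) (E v 0) else 0)) \<and>
        (\<forall>i n. E (X i n v) 0 = twist (- \<tau> * \<omega> i) (X i) n (E v 0)))"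

text \<open>The modes of \<open>Z(x)E(x)\<close>.\<close>

definition dress :: "('v \<Rightarrow> int \<Rightarrow> 'v) \<Rightarrow> (int \<Rightarrow> 'v \<Rightarrow> 'v) \<Rightarrow> int \<Rightarrow> 'v \<Rightarrow> 'v" where
  "dress E Z n v = Sum_any (\<lambda>m. Z (n + m) (E v m))"

lemma field_series_dress: "field_series (dress E Z) v = laurent_ext (field_series Z) (E v)"
  by (simp add: field_series_def dress_def laurent_ext_def algebra_simps)

context
  fixes \<tau> E
  assumes E: "exponential \<tau> E"
begin

lemma exponential_linear: "endo (\<lambda>v. E v k)"
  using E by (simp add: exponential_def)

lemma exponential_weight: "weight l v \<Longrightarrow> weight l (E v 0)"
  using E unfolding exponential_def by blast

lemma exponential_coeff:
  "weight l v \<Longrightarrow> E v k = (if k \<ge> 0 then s (dpow (\<tau> * l) (nat k)) (E v 0) else 0)"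
  using E unfolding exponential_def by blast

lemma exponential_twist:
  "weight l v \<Longrightarrow> E (twist c (X i) n v) 0 = twist (- \<tau> * \<omega> i + c) (X i) n (E v 0)"
  using E unfolding exponential_def
  by (intro twist_intertwine[where T = "\<lambda>v. E v 0"] X_field) blast+

context
  fixes Z
  assumes Z: "is_field Z"
begin

text \<open>On weight \<open>l\<close> the series \<open>E v\<close> is e^(\<tau>lx) times a
  constant vector, and the scalar factor can be moved onto \<open>Z\<close>.\<close>

lemma dress_weight:
  assumes v: "weight l v"
  shows "finite {m. Z (n + m) (E v m) \<noteq> 0}" (is ?fin)
    and "dress E Z n v = twist (\<tau> * l) Z n (E v 0)" (is ?eq)
proof -
  note lin = is_field_linear[OF Z]
  obtain K where K: "\<And>j. j \<ge> K \<Longrightarrow> Z (n + int j) (E v 0) = 0"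
    using is_field_truncated[OF Z] truncatedD_nat by meson
  \<comment> \<open>\<open>E v\<close> has no negative powers, and its other coefficients are
    multiples of \<open>E v 0\<close>, which the modes of \<open>Z\<close> kill from
    \<open>K\<close> on.\<close>
  have 0: "Z (n + m) (E v m) = 0" if "m \<notin> int ` {..<K}" for m
  proof (cases "m \<ge> 0")
    case True
    with that have "nat m \<ge> K" by (metis image_eqI int_nat_eq lessThan_iff not_le)
    with K[of "nat m"] True show ?thesis
      by (simp add: exponential_coeff[OF v, of m] linear_scaleD[OF lin])
  next
    case False
    then show ?thesis by (simp add: exponential_coeff[OF v, of m] linear_zeroD[OF lin])
  qed
  show ?fin
    by (rule finite_subset[of _ "int ` {..<K}"]) (use 0 in blast, simp)
  have "dress E Z n v = (\<Sum>m\<in>int ` {..<K}. Z (n + m) (E v m))"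
    unfolding dress_def using 0 by (intro Sum_any_eq_sum) auto
  also have "\<dots> = (\<Sum>j<K. Z (n + int j) (E v (int j)))"
    by (simp add: sum.reindex)
  also have "\<dots> = (\<Sum>j<K. s (dpow (\<tau> * l) j) (Z (n + int j) (E v 0)))"
    by (intro sum.cong) (auto simp: exponential_coeff[OF v, of "int _"] linear_scaleD[OF lin])
  also have "\<dots> = twist (\<tau> * l) Z n (E v 0)"
    by (rule twist_eq_sum[symmetric]) (rule K)
  finally show ?eq .
qed

text \<open>\<open>Sum_any\<close> is additive over finite supports, so this comes before the
  linearity of \<open>dress\<close>.\<close>

lemma dress_finite: "finite {m. Z (n + m) (E v m) \<noteq> 0}"
proof (induction v rule: weight_decompose_induct)
  case (weight l v)
  then show ?case by (rule dress_weight)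
next
  case (add x y)
  show ?case
    by (rule finite_subset[OF _ finite_UnI[OF add]])
      (auto simp: linear_addD[OF exponential_linear] linear_addD[OF is_field_linear[OF Z]])
qed

lemma dress_field: "is_field (dress E Z)"
proof -
  have dress_add: "dress E Z n (x + y) = dress E Z n x + dress E Z n y" for n x y
    unfolding dress_def
    by (simp add: linear_addD[OF exponential_linear] linear_addD[OF is_field_linear[OF Z]]
        Sum_any.distrib dress_finite)
  have dress_scale: "dress E Z n (s c x) = s c (dress E Z n x)" for n c x
  proof -
    let ?S = "{m. Z (n + m) (E x m) \<noteq> 0}"
    have "dress E Z n (s c x) = (\<Sum>m\<in>?S. s c (Z (n + m) (E x m)))"
      unfolding dress_def linear_scaleD[OF exponential_linear] linear_scaleD[OF is_field_linear[OF Z]]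
      by (rule Sum_any_eq_sum) (use dress_finite in auto)
    then show ?thesis
      by (simp add: dress_def scale_sum_right Sum_any.expand_set)
  qed
  have "\<exists>K. \<forall>n\<ge>K. dress E Z n v = 0" for v
  proof (induction v rule: weight_decompose_induct)
    case (weight l v)
    then show ?case
      using twist_truncated[OF is_field_truncated[OF Z]] by (simp add: dress_weight truncated_def)
  next
    case (add x y)
    then obtain K L where "\<forall>n\<ge>K. dress E Z n x = 0" "\<forall>n\<ge>L. dress E Z n y = 0" by blast
    then have "\<forall>n\<ge>max K L. dress E Z n (x + y) = 0" by (simp add: dress_add)
    then show ?case by blast
  qed
  then show ?thesis
    by (auto simp: is_field_def truncated_def intro!: linearI dress_add dress_scale)
qed

end

end

text \<open>The inner result has weight \<open>l + \<omega> j\<close>, which fixes the outer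
  exponent; carrying the constant term of \<open>E\<close> across \<open>X j\<close> shifts the
  inner one by \<open>- \<tau> * \<omega> j\<close>.\<close>

lemma dress_dress:
  assumes E: "exponential \<tau> E" and E': "exponential \<tau>' E'" and v: "weight l v"
  shows "dress E (X i) m (dress E' (X j) n v)
    = twist (\<tau> * (l + \<omega> j)) (X i) m (twist (\<tau>' * l - \<tau> * \<omega> j) (X j) n (E (E' v 0) 0))"
  using v exponential_weight[OF E' v]
  by (simp add: dress_weight[OF E' X_field v] dress_weight[OF E X_field weight_twist]
      exponential_twist[OF E])

text \<open>By \<open>dress_dress\<close> both orders are products of twisted modes on a common
  vector. The given \<open>\<epsilon>\<close> makes their exponents agree, and
  \<open>twist_anticommute\<close> applies.\<close>

lemma dress_twisted_relation:
  assumes E: "exponential \<tau> E" and E': "exponential \<tau>' E'"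
    and E_E': "\<And>l v. weight l v \<Longrightarrow> E (E' v 0) 0 = E' (E v 0) 0"
    and comm: "\<And>m n v. X i m (X j n v) + X j n (X i m v) = s (if m + n + 1 = 0 then \<kappa> else 0) v"
    and \<kappa>: "\<kappa> = 0 \<or> \<tau> + \<tau>' = 0 \<and> (\<forall>l v. weight l v \<longrightarrow> E (E' v 0) 0 = v)"
    and \<epsilon>: "\<epsilon> = - (\<tau> * \<omega> j + \<tau>' * \<omega> i)"
  shows "twisted_relation s \<epsilon> \<kappa> (dress E (X i)) (dress E' (X j))"
proof -
  let ?U = "dress E (X i)" and ?V = "dress E' (X j)"
  have U: "is_field ?U" and V: "is_field ?V"
    using dress_field X_field E E' by blast+
  have "?U m (?V n v) + twist \<epsilon> ?V n (twist (- \<epsilon>) ?U m v) = s (if m + n + 1 = 0 then \<kappa> else 0) v"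
    for m n v
  proof (induction v rule: weight_decompose_induct)
    case (weight l v)
    define u where "u = E (E' v 0) 0"
    define p q where "p = \<tau> * (l + \<omega> j)" and "q = \<tau>' * l - \<tau> * \<omega> j"
    have UV: "?U m (?V n v) = twist p (X i) m (twist q (X j) n u)"
      using dress_dress[OF E E' weight] by (simp add: u_def p_def q_def)
    have "twist \<epsilon> ?V n (twist (- \<epsilon>) ?U m v)
        = twist (\<epsilon> + \<tau>' * (l + \<omega> i)) (X j) n (twist (- \<epsilon> + (\<tau> * l - \<tau>' * \<omega> i)) (X i) m u)"
      by (rule twist_composition[OF U V X_field X_field])
        (simp add: dress_dress[OF E' E weight] u_def E_E'[OF weight])
    moreover have "\<epsilon> + \<tau>' * (l + \<omega> i) = q" "- \<epsilon> + (\<tau> * l - \<tau>' * \<omega> i) = p"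
      by (simp_all add: \<epsilon> p_def q_def algebra_simps)
    ultimately have VU: "twist \<epsilon> ?V n (twist (- \<epsilon>) ?U m v) = twist q (X j) n (twist p (X i) m u)"
      by simp
    \<comment> \<open>A delta term requires \<open>p + q = 0\<close> for every weight, hence
      opposite signs \<open>\<tau>\<close> and \<open>\<tau>'\<close>.\<close>
    have "p + q = (\<tau> + \<tau>') * l"
      by (simp add: p_def q_def algebra_simps)
    then have pq: "\<kappa> = 0 \<or> p + q = 0"
      using \<kappa> by auto
    have "?U m (?V n v) + twist \<epsilon> ?V n (twist (- \<epsilon>) ?U m v) = s (if m + n + 1 = 0 then \<kappa> else 0) u"
      unfolding UV VU by (rule twist_anticommute[OF X_field X_field comm pq])
    \<comment> \<open>With a delta term the two constant terms cancel; without one the right side is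
      0.\<close>
    moreover have "\<kappa> = 0 \<or> u = v"
      using \<kappa> weight by (auto simp: u_def)
    ultimately show ?case by auto
  next
    case (add x y)
    have "?U m (?V n (x + y)) + twist \<epsilon> ?V n (twist (- \<epsilon>) ?U m (x + y))
       = (?U m (?V n x) + twist \<epsilon> ?V n (twist (- \<epsilon>) ?U m x))
         + (?U m (?V n y) + twist \<epsilon> ?V n (twist (- \<epsilon>) ?U m y))"
      by (simp add: linear_addD[OF is_field_linear] linear_addD[OF twist_linear] U V algebra_simps)
    with add show ?case by (simp add: scale_right_distrib)
  qed
  then show ?thesis
    by (simp add: twisted_relation_iff U V)
qed

end

section \<open>Pseudo-automorphisms that multiply the generators by exponentials\<close>

locale pseudo_weighted_module = weighted_module s "\<lambda>i. Y (F i)" \<omega> vac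
  for s :: "complex \<Rightarrow> 'v::ab_group_add \<Rightarrow> 'v" and Y :: "'v \<Rightarrow> int \<Rightarrow> 'v \<Rightarrow> 'v"
    and F :: "'i \<Rightarrow> 'v" and \<omega> :: "'i \<Rightarrow> complex" and vac :: 'v +
  fixes D :: "'v \<Rightarrow> int \<Rightarrow> 'v"
  assumes Y_linear_left: "Vector_Spaces.linear s s (\<lambda>u. Y u n v)"
    and pseudo: "pseudo_automorphism s vac Y D"
    and D_F: "D (F i) = tensor s (F i) (fps_to_fls (fps_exp (\<omega> i)))"
begin

lemma D_tensor_space: "D v \<in> tensor_space s"
  and D_linear: "endo (\<lambda>v. D v k)"
  and D_vac: "D vac = tensor s vac 1"
  and D_Y: "D (Y u n v) p = Sum_any (\<lambda>(k::int, j::nat). s ((-1) ^ j * (of_int k gchoose j))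
          (Y (D u k) (n + int j) (D v (p - (k - int j)))))"
  and D_bij: "bij_betw (laurent_ext D) (tensor_space s) (tensor_space s)"
  using pseudo unfolding pseudo_automorphism_def pseudo_endomorphism_def by blast+

text \<open>The image of the field on \<open>v\<close> is e^(\<omega>(x-z)) Y(F,z) e^(lx)
  \<open>D v 0\<close>: the powers of x give the exponent \<open>l + \<omega> i\<close>, those of z
  the twist by \<open>- \<omega> i\<close>.\<close>

lemma D_mode:
  assumes v: "\<And>k. D v k = (if k \<ge> 0 then s (dpow l (nat k)) (D v 0) else 0)"
  shows "D (Y (F i) n v) p
    = (if p \<ge> 0 then s (dpow (l + \<omega> i) (nat p)) (twist (- \<omega> i) (Y (F i)) n (D v 0)) else 0)"
proof -
  let ?t = "\<lambda>(k::int, j::nat). s ((-1) ^ j * (of_int k gchoose j))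
          (Y (D (F i) k) (n + int j) (D v (p - (k - int j))))"
  \<comment> \<open>Reindexing by a = k - j, the power of x that remains in (x-z)^k, prepares for
    \<open>dpow_binomial\<close>.\<close>
  let ?g = "\<lambda>(a::nat, j::nat). (int (a + j), j)"
  obtain K where K: "\<And>j. j \<ge> K \<Longrightarrow> Y (F i) (n + int j) (D v 0) = 0"
    using X_truncated truncatedD_nat by meson
  have t: "?t (?g (a, j)) = (if int a \<le> p
      then s (dpow (\<omega> i) a * dpow (- \<omega> i) j * dpow l (nat p - a)) (Y (F i) (n + int j) (D v 0)) else 0)"
    for a j
  proof -
    have F: "D (F i) (int (a + j)) = s (dpow (\<omega> i) (a + j)) (F i)"
      by (simp add: D_F tensor_exp_nth del: of_nat_add)
    have "p - (int (a + j) - int j) = p - int a" by simp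
    moreover have "D v (p - int a) = (if int a \<le> p then s (dpow l (nat p - a)) (D v 0) else 0)"
      unfolding v[of "p - int a"] by (simp add: nat_diff_distrib')
    ultimately have V: "D v (p - (int (a + j) - int j))
        = (if int a \<le> p then s (dpow l (nat p - a)) (D v 0) else 0)"
      by (simp only:)
    have "?t (?g (a, j)) = s ((- 1) ^ j * (of_nat (a + j) gchoose j) * dpow (\<omega> i) (a + j))
        (Y (F i) (n + int j) (D v (p - (int (a + j) - int j))))"
      by (simp only: prod.case F linear_scaleD[OF Y_linear_left] scale_scale of_int_of_nat_eq)
    then show ?thesis
      unfolding V dpow_binomial
      by (simp add: linear_scaleD[OF X_linear] linear_zeroD[OF X_linear])
  qed
  \<comment> \<open>a \<le> p because \<open>D v\<close> has no negative powers, and j < K by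
    truncation.\<close>
  define S where "S = (if p \<ge> 0 then {..nat p} \<times> {..<K} else {})"
  have "?t x = 0" if x: "x \<notin> ?g ` S" for x
  proof -
    obtain k j where kj: "x = (k, j)" by force
    show ?thesis
    proof (cases "k \<ge> int j")
      case True
      define a where "a = nat (k - int j)"
      have "x = ?g (a, j)" using True by (simp add: kj a_def)
      moreover from this x have "(a, j) \<notin> S" by blast
      then have "p < int a \<or> j \<ge> K" by (auto simp: S_def split: if_splits)
      ultimately show ?thesis
        using K by (simp only: t) auto
    next
      case False
      \<comment> \<open>Negative powers are absent from \<open>D (F i)\<close>, and for 0 \<le> k <
        j the binomial coefficient vanishes.\<close>
      have "k < 0 \<or> (\<exists>k'. k = int k' \<and> k' < j)"
        using False by (metis not_le of_nat_less_iff zero_le_imp_eq_int)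
      then show ?thesis
        by (auto simp: kj D_F tensor_exp_nth linear_zeroD[OF Y_linear_left]
            simp flip: binomial_gbinomial)
    qed
  qed
  then have "D (Y (F i) n v) p = sum ?t (?g ` S)"
    unfolding D_Y by (intro Sum_any_eq_sum) (auto simp: S_def)
  also have "\<dots> = (\<Sum>x\<in>S. ?t (?g x))"
    by (rule sum.reindex_cong[of ?g]) (auto simp: inj_on_def)
  also have "\<dots> = (if p \<ge> 0 then s (dpow (l + \<omega> i) (nat p)) (twist (- \<omega> i) (Y (F i)) n (D v 0)) else 0)"
  proof (cases "p \<ge> 0")
    case True
    have "(\<Sum>x\<in>S. ?t (?g x)) = (\<Sum>(a,j)\<in>S. s (dpow (\<omega> i) a * dpow l (nat p - a))
        (s (dpow (- \<omega> i) j) (Y (F i) (n + int j) (D v 0))))"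
    proof (rule sum.cong[OF refl])
      fix x
      assume "x \<in> S"
      then obtain a j where x: "x = (a, j)" "int a \<le> p"
        using True by (cases x) (auto simp: S_def)
      show "?t (?g x) = (case x of (a, j) \<Rightarrow> s (dpow (\<omega> i) a * dpow l (nat p - a))
          (s (dpow (- \<omega> i) j) (Y (F i) (n + int j) (D v 0))))"
        unfolding x(1) t using x(2) by (simp add: mult_ac)
    qed
    also have "\<dots> = (\<Sum>a\<le>nat p. s (dpow (\<omega> i) a * dpow l (nat p - a)) (twist (- \<omega> i) (Y (F i)) n (D v 0)))"
      using True by (simp add: S_def sum.cartesian_product[symmetric] scale_sum_right
          twist_eq_sum[of K "Y (F i)" n "D v 0", OF K])
    also have "\<dots> = s (dpow (\<omega> i + l) (nat p)) (twist (- \<omega> i) (Y (F i)) n (D v 0))"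
      by (simp add: scale_sum_left[symmetric] dpow_add)
    finally show ?thesis using True by (simp add: add.commute)
  qed (simp add: S_def)
  finally show ?thesis .
qed

text \<open>Induction along \<open>weight\<close>; the property \<open>scales\<close> is carried
  along because \<open>D_mode\<close> assumes it of \<open>v\<close>.\<close>

lemma D_weight:
  assumes "weight l v"
  shows "weight l (D v 0)"
    and "D v k = (if k \<ge> 0 then s (dpow l (nat k)) (D v 0) else 0)"
proof -
  define scales where
    "scales l v \<longleftrightarrow> (\<forall>k. D v k = (if k \<ge> 0 then s (dpow l (nat k)) (D v 0) else 0))" for l v
  have scalesD: "D v k = (if k \<ge> 0 then s (dpow l (nat k)) (D v 0) else 0)" if "scales l v" for l v k
    using that unfolding scales_def by blast
  have "weight l (D v 0) \<and> scales l v"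
    using assms
  proof induction
    case vac
    then show ?case
      by (auto simp: scales_def D_vac tensor_def dpow_0_left intro: weight.vac)
  next
    case (mode l v i n)
    then have eq: "D (Y (F i) n v) p
        = (if p \<ge> 0 then s (dpow (l + \<omega> i) (nat p)) (twist (- \<omega> i) (Y (F i)) n (D v 0)) else 0)" for p
      by (intro D_mode scalesD) blast
    have "weight (l + \<omega> i) (twist (- \<omega> i) (Y (F i)) n (D v 0))"
      using mode by (intro weight_twist) blast
    then show ?case unfolding scales_def eq by simp
  next
    case (zero l)
    then show ?case by (simp add: scales_def linear_zeroD[OF D_linear] weight.zero)
  next
    case (add l v w)
    have "D v k + D w k = (if k \<ge> 0 then s (dpow l (nat k)) (D v 0 + D w 0) else 0)" for k
      using scalesD[of l v k] scalesD[of l w k] add.IH by (simp add: scale_right_distrib)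
    then show ?case
      using add.IH unfolding scales_def linear_addD[OF D_linear] by (blast intro: weight.add)
  next
    case (scale l v c)
    have "s c (D v k) = (if k \<ge> 0 then s (dpow l (nat k)) (s c (D v 0)) else 0)" for k
      using scalesD[of l v k] scale.IH by (simp add: mult.commute)
    then show ?case
      using scale.IH unfolding scales_def linear_scaleD[OF D_linear] by (blast intro: weight.scale)
  qed
  then show "weight l (D v 0)" "D v k = (if k \<ge> 0 then s (dpow l (nat k)) (D v 0) else 0)"
    using scalesD by blast+
qed

lemma D_exponential: "exponential 1 D"
  unfolding exponential_def
proof (intro conjI allI impI)
  fix l v
  assume v: "weight l v"
  then show "weight l (D v 0)"
    by (rule D_weight)
  show "D v k = (if k \<ge> 0 then s (dpow (1 * l) (nat k)) (D v 0) else 0)" for k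
    unfolding mult_1 by (rule D_weight[OF v])
  show "D (Y (F i) n v) 0 = twist (- 1 * \<omega> i) (Y (F i)) n (D v 0)" for i n
    using D_mode[OF D_weight(2)[OF v], of i n 0] by simp
qed (rule D_linear)

text \<open>Preimages are built along \<open>weight\<close>: the constant term of \<open>D\<close>
  twists a field by \<open>- \<omega> i\<close>, so it sends the mode twisted by
  \<open>\<omega> i\<close> to the plain mode.\<close>

lemma D_surj:
  assumes "weight l v"
  shows "\<exists>u. weight l u \<and> D u 0 = v"
  using assms
proof induction
  case vac
  then show ?case by (intro exI[of _ vac]) (simp add: weight.vac D_vac tensor_def)
next
  case (mode l v i n)
  then obtain u where u: "weight l u" "D u 0 = v" by blast
  have "D (twist (\<omega> i) (Y (F i)) n u) 0 = Y (F i) n v"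
    by (simp add: exponential_twist[OF D_exponential u(1)] u(2))
  with u show ?case using weight_twist by blast
next
  case (zero l)
  then show ?case using weight.zero linear_zeroD[OF D_linear] by blast
next
  case (add l v w)
  then show ?case using weight.add linear_addD[OF D_linear] by metis
next
  case (scale l v c)
  then show ?case using weight.scale linear_scaleD[OF D_linear] by metis
qed

section \<open>The inverse pseudo-automorphism on weight vectors\<close>

abbreviation Dinv :: "'v \<Rightarrow> int \<Rightarrow> 'v" where
  "Dinv \<equiv> pseudo_inverse s D"

lemma Dinv_tensor_space: "Dinv v \<in> tensor_space s"
  and laurent_ext_Dinv: "laurent_ext D (Dinv v) = tensor s v 1"
proof -
  have "tensor s v 1 \<in> laurent_ext D ` tensor_space s"
    using D_bij tensor_space_tensor by (simp add: bij_betw_def)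
  then show "Dinv v \<in> tensor_space s" "laurent_ext D (Dinv v) = tensor s v 1"
    unfolding pseudo_inverse_def by (rule inv_into_into, rule f_inv_into_f)
qed

lemma Dinv_eqI:
  assumes "U \<in> tensor_space s" "laurent_ext D U = tensor s v 1"
  shows "Dinv v = U"
  using assms D_bij unfolding pseudo_inverse_def by (auto simp: bij_betw_def intro: inv_into_f_eq)

text \<open>Preimages under \<open>laurent_ext D\<close> are unique, and sums and multiples of
  preimages are again preimages.\<close>

lemma Dinv_linear: "endo (\<lambda>v. Dinv v k)"
proof (rule linearI)
  fix v w
  have "Dinv (v + w) = (\<lambda>k. Dinv v k + Dinv w k)"
    by (rule Dinv_eqI)
      (auto simp: laurent_ext_add[OF D_linear D_tensor_space] Dinv_tensor_space laurent_ext_Dinv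
        tensor_def scale_right_distrib intro: tensor_space_add)
  then show "Dinv (v + w) k = Dinv v k + Dinv w k" by simp
next
  fix c v
  have "Dinv (s c v) = (\<lambda>k. s c (Dinv v k))"
    by (rule Dinv_eqI)
      (auto simp: laurent_ext_scale[OF D_linear D_tensor_space] Dinv_tensor_space laurent_ext_Dinv
        tensor_def mult.commute intro: tensor_space_scale)
  then show "Dinv (s c v) k = s c (Dinv v k)" by simp
qed

text \<open>The factor e^(lx) produced by \<open>D\<close> on weight \<open>l\<close> cancels
  e^(-lx), so this tensor is sent to the constant series \<open>D u 0\<close>.\<close>

lemma Dinv_eq:
  assumes u: "weight l u"
  shows "Dinv (D u 0) = tensor s u (fps_to_fls (fps_exp (- l)))"
proof (rule Dinv_eqI[OF tensor_space_tensor], rule ext)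
  fix k
  let ?W = "tensor s u (fps_to_fls (fps_exp (- l)))"
  have W: "D (?W m) (k - m) = (if 0 \<le> m \<and> m \<le> k
      then s (dpow (- l) (nat m) * dpow l (nat k - nat m)) (D u 0) else 0)" for m
    using exponential_coeff[OF D_exponential u, of "k - m"]
    by (auto simp: tensor_exp_nth linear_scaleD[OF D_linear] linear_zeroD[OF D_linear]
        nat_diff_distrib)
  show "laurent_ext D ?W k = tensor s (D u 0) 1 k"
  proof (cases "k \<ge> 0")
    case True
    have "laurent_ext D ?W k = (\<Sum>m\<in>int ` {..nat k}. D (?W m) (k - m))"
      unfolding laurent_ext_def
    proof (rule Sum_any_eq_sum)
      fix m
      assume "m \<notin> int ` {..nat k}"
      then have "\<not> (0 \<le> m \<and> m \<le> k)" by (auto simp: image_iff) (metis nat_mono atMost_iff int_nat_eq)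
      then show "D (?W m) (k - m) = 0" by (auto simp: W)
    qed simp
    also have "\<dots> = (\<Sum>m\<le>nat k. s (dpow (- l) m * dpow l (nat k - m)) (D u 0))"
      using True by (simp add: sum.reindex W) (intro sum.cong refl, auto simp: le_nat_iff)
    also have "\<dots> = s (dpow 0 (nat k)) (D u 0)"
      by (simp add: scale_sum_left[symmetric] dpow_add)
    finally show ?thesis
      using True by (simp add: dpow_0_left tensor_def)
  next
    case False
    then have "D (?W m) (k - m) = 0" for m by (auto simp: W)
    then show ?thesis using False by (simp add: laurent_ext_def tensor_def)
  qed
qed

lemma Dinv_D:
  assumes "weight l v"
  shows "Dinv (D v 0) 0 = v"
  by (simp add: Dinv_eq[OF assms] tensor_exp_nth)

text \<open>\<open>D_surj\<close> gives \<open>v = D u 0\<close> with \<open>u\<close> of the same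
  weight, so \<open>Dinv_eq\<close> covers all weight vectors.\<close>

lemma Dinv_weight:
  assumes v: "weight l v"
  shows "weight l (Dinv v 0)" and "D (Dinv v 0) 0 = v"
    and "Dinv v k = (if k \<ge> 0 then s (dpow (- l) (nat k)) (Dinv v 0) else 0)"
proof -
  obtain u where u: "weight l u" "D u 0 = v" using D_surj[OF v] by blast
  have "Dinv v 0 = u" using Dinv_D[OF u(1)] u(2) by simp
  with u Dinv_eq[OF u(1)] show "weight l (Dinv v 0)" "D (Dinv v 0) 0 = v"
    "Dinv v k = (if k \<ge> 0 then s (dpow (- l) (nat k)) (Dinv v 0) else 0)"
    by (simp_all add: tensor_exp_nth)
qed

lemma Dinv_exponential: "exponential (- 1) Dinv"
  unfolding exponential_def
proof (intro conjI allI impI)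
  fix l v
  assume v: "weight l v"
  show "weight l (Dinv v 0)"
    and "Dinv v k = (if k \<ge> 0 then s (dpow (- 1 * l) (nat k)) (Dinv v 0) else 0)" for k
    using Dinv_weight(1)[OF v] Dinv_weight(3)[OF v, of k] by simp_all
  show "Dinv (Y (F i) n v) 0 = twist (- (- 1) * \<omega> i) (Y (F i)) n (Dinv v 0)" for i n
  proof -
    \<comment> \<open>The twist of \<open>?u\<close> is the one that \<open>D\<close> undoes, so
      \<open>?u\<close> is the preimage of \<open>Y (F i) n v\<close>.\<close>
    let ?u = "twist (\<omega> i) (Y (F i)) n (Dinv v 0)"
    have "D ?u 0 = Y (F i) n v"
      by (simp add: exponential_twist[OF D_exponential Dinv_weight(1)[OF v]] Dinv_weight(2)[OF v])
    moreover have "weight (l + \<omega> i) ?u"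
      by (intro weight_twist Dinv_weight(1)[OF v])
    ultimately show ?thesis
      using Dinv_D by force
  qed
qed (rule Dinv_linear)

lemma D_D_relation:
  assumes "\<And>m n v. Y (F i) m (Y (F j) n v) + Y (F j) n (Y (F i) m v) = 0"
  shows "twisted_relation s (- (\<omega> i + \<omega> j)) 0 (dress D (Y (F i))) (dress D (Y (F j)))"
  using assms by (intro dress_twisted_relation[OF D_exponential D_exponential]) auto

lemma Dinv_Dinv_relation:
  assumes "\<And>m n v. Y (F i) m (Y (F j) n v) + Y (F j) n (Y (F i) m v) = 0"
  shows "twisted_relation s (\<omega> i + \<omega> j) 0 (dress Dinv (Y (F i))) (dress Dinv (Y (F j)))"
  using assms by (intro dress_twisted_relation[OF Dinv_exponential Dinv_exponential]) auto

lemma D_Dinv_relation: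
  assumes "\<And>m n v. Y (F i) m (Y (F j) n v) + Y (F j) n (Y (F i) m v)
    = s (if m + n + 1 = 0 then \<kappa> else 0) v"
  shows "twisted_relation s (\<omega> i - \<omega> j) \<kappa> (dress D (Y (F i))) (dress Dinv (Y (F j)))"
  using assms
  by (intro dress_twisted_relation[OF D_exponential Dinv_exponential])
    (auto simp: Dinv_weight(2) Dinv_D)

text \<open>\<open>vac\<close> has weight 0 and is fixed by both constant terms, so no exponential
  appears.\<close>

lemma dress_D_vac: "dress D (Y (F i)) n vac = Y (F i) n vac"
  and dress_Dinv_vac: "dress Dinv (Y (F i)) n vac = Y (F i) n vac"
proof -
  have D_vac_0: "D vac 0 = vac"
    by (simp add: D_vac tensor_def)
  then have "Dinv vac 0 = vac"
    using Dinv_D[OF weight.vac] by simp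
  with D_vac_0 show "dress D (Y (F i)) n vac = Y (F i) n vac" "dress Dinv (Y (F i)) n vac = Y (F i) n vac"
    using dress_weight(2)[OF D_exponential X_field weight.vac]
      dress_weight(2)[OF Dinv_exponential X_field weight.vac] by simp_all
qed

end

section \<open>The Clifford module\<close>

lemma free_alg_induct [case_names single add]:
  fixes x :: free_alg
  assumes single: "\<And>w c. Q (Poly_Mapping.single w c)"
    and add: "\<And>x y. Q x \<Longrightarrow> Q y \<Longrightarrow> Q (x + y)"
  shows "Q x"
proof -
  have sum: "Q (\<Sum>w\<in>S. Poly_Mapping.single w (Poly_Mapping.lookup x w))" for S
    using single[of 0 0] by (induction S rule: infinite_finite_induct) (auto intro: single add)
  have "x = (\<Sum>w\<in>Poly_Mapping.keys x. Poly_Mapping.single w (Poly_Mapping.lookup x w))"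
    by (rule poly_mapping_eqI)
      (auto simp: lookup_sum lookup_single when_def in_keys_iff)
  then show ?thesis using sum by metis
qed

context
  includes clifford.lifting
begin

text \<open>Words in the generators span, and each arises from 1 by left multiplications.\<close>

lemma clifford_induct [case_names one gen add scale]:
  assumes one: "Q 1"
    and gen: "\<And>g x. Q x \<Longrightarrow> Q (clifford_gen g * x)"
    and add: "\<And>x y. Q x \<Longrightarrow> Q y \<Longrightarrow> Q (x + y)"
    and scale: "\<And>c x. Q x \<Longrightarrow> Q (clifford_scale c x)"
  shows "Q x"
proof -
  have word: "Q (abs_clifford (Poly_Mapping.single (Word gs) 1))" for gs
  proof (induction gs)
    case Nil
    then show ?case
      using one by (simp add: one_clifford.abs_eq flip: zero_word_def single_one)
  next
    case (Cons g gs)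
    have "Poly_Mapping.single (Word (g # gs)) 1 = free_gen g * Poly_Mapping.single (Word gs) 1"
      by (simp add: free_gen_def mult_single)
    then show ?case
      using gen[OF Cons, of g] by (simp add: clifford_gen.abs_eq times_clifford.abs_eq)
  qed
  have "Q (abs_clifford y)" for y
  proof (induction y rule: free_alg_induct)
    case (single w c)
    have "Poly_Mapping.single w c = free_scale c (Poly_Mapping.single w 1)"
      by (simp add: free_scale_def mult_single)
    then show ?case
      using scale[OF word, of c] by (cases w) (simp add: clifford_scale.abs_eq)
  next
    case (add x y)
    then show ?case using assms(3) by (metis plus_clifford.abs_eq)
  qed
  then show ?thesis by (induction x rule: clifford.abs_induct)
qed

lemma abs_clifford_relator: "x \<in> clifford_relators \<Longrightarrow> abs_clifford x = 0"
  by (simp add: zero_clifford.abs_eq clifford.abs_eq_iff clifford_cong_def two_sided_ideal.base)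

lemma gen_a_anticommute: "gen_a m * gen_a n + gen_a n * gen_a m = 0"
proof -
  have "abs_clifford (free_gen (A m) * free_gen (A n) + free_gen (A n) * free_gen (A m)) = 0"
    by (rule abs_clifford_relator) (auto simp: clifford_relators_def)
  then show ?thesis
    by (simp add: plus_clifford.abs_eq times_clifford.abs_eq clifford_gen.abs_eq)
qed

lemma gen_b_anticommute: "gen_b m * gen_b n + gen_b n * gen_b m = 0"
proof -
  have "abs_clifford (free_gen (B m) * free_gen (B n) + free_gen (B n) * free_gen (B m)) = 0"
    by (rule abs_clifford_relator) (auto simp: clifford_relators_def)
  then show ?thesis
    by (simp add: plus_clifford.abs_eq times_clifford.abs_eq clifford_gen.abs_eq)
qed

lemma gen_a_gen_b_anticommute:
  "gen_a m * gen_b n + gen_b n * gen_a m = (if m + n + 1 = 0 then 1 else 0)"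
proof -
  have "abs_clifford (free_gen (A m) * free_gen (B n) + free_gen (B n) * free_gen (A m)
      - (if m + n + 1 = 0 then 1 else 0)) = 0"
    by (rule abs_clifford_relator) (unfold clifford_relators_def, blast)
  then show ?thesis
    by (auto simp: plus_clifford.abs_eq times_clifford.abs_eq clifford_gen.abs_eq
        simp flip: minus_clifford.abs_eq one_clifford.abs_eq zero_clifford.abs_eq split: if_splits)
qed

end

lemma vc_act_add_left: "vc_act (x + y) v = vc_act x v + vc_act y v"
  by transfer (simp add: distrib_right vc_cong_refl)

lemma vc_act_mult: "vc_act (x * y) v = vc_act x (vc_act y v)"
  by transfer (simp add: mult.assoc vc_cong_refl)

lemma vc_act_one: "vc_act 1 v = v"
  by transfer (simp add: vc_cong_refl)

lemma vc_act_zero: "vc_act 0 v = 0"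
  by transfer (simp add: vc_cong_refl)

lemma vc_act_scale_left: "vc_act (clifford_scale c x) v = vc_scale c (vc_act x v)"
  by transfer (metis clifford_scale_mult mult.assoc vc_cong_refl)

lemma vc_act_vc_one: "\<exists>x. v = vc_act x vc_one"
  by transfer (metis mult_1_right vc_cong_refl)

lemma vc_cyclic:
  assumes "vc.subspace W" "vc_one \<in> W" "\<And>g v. v \<in> W \<Longrightarrow> vc_act (clifford_gen g) v \<in> W"
  shows "W = UNIV"
proof -
  have "vc_act x vc_one \<in> W" for x
    by (induction x rule: clifford_induct)
      (use assms in \<open>auto simp: vc_act_one vc_act_mult vc_act_add_left vc_act_scale_left
         intro: vc.subspace_add vc.subspace_scale\<close>)
  then have "v \<in> W" for v using vc_act_vc_one[of v] by auto
  then show ?thesis by blast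
qed

text \<open>
  The Fock module, which shows \<open>1 \<notin> J\<^sub>+\<close>: states are functions on sets of occupied slots, the
  modes \<open>a\<^sub>n\<close> and \<open>b\<^bsub>-n-1\<^esub>\<close> share a slot, and negative modes create. Numbering the slots by
  natural numbers makes the sign well-defined for infinite sets too.
\<close>

type_synonym fock = "nat set \<Rightarrow> complex"

definition slot_sign :: "nat \<Rightarrow> nat set \<Rightarrow> complex" where
  "slot_sign k T = (- 1) ^ card {t \<in> T. t < k}"

definition create :: "nat \<Rightarrow> fock \<Rightarrow> fock" where
  "create k f T = (if k \<in> T then slot_sign k T * f (T - {k}) else 0)"

definition annihilate :: "nat \<Rightarrow> fock \<Rightarrow> fock" where
  "annihilate k f T = (if k \<in> T then 0 else slot_sign k T * f (insert k T))"

lemma slot_sign_insert: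
  assumes "l \<notin> T"
  shows "slot_sign k (insert l T) = (if l < k then - slot_sign k T else slot_sign k T)"
proof -
  have "{t \<in> insert l T. t < k} = (if l < k then insert l {t \<in> T. t < k} else {t \<in> T. t < k})"
    by auto
  with assms show ?thesis by (simp add: slot_sign_def)
qed

lemma slot_sign_remove:
  assumes "l \<in> T"
  shows "slot_sign k (T - {l}) = (if l < k then - slot_sign k T else slot_sign k T)"
  using slot_sign_insert[of l "T - {l}" k] assms by (auto simp: insert_absorb)

lemma slot_sign_square: "slot_sign k T * (slot_sign k T * z) = z"
  by (simp add: slot_sign_def flip: mult.assoc power_add mult_2)

text \<open>Removing the lower slot flips the sign of the higher one but not conversely, so the two
  orders differ by -1. For k = l both terms vanish.\<close>

lemma create_anticommute: "create k (create l f) T + create l (create k f) T = 0"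
  by (auto simp: create_def slot_sign_remove Diff_insert2[symmetric] insert_commute)

lemma annihilate_anticommute: "annihilate k (annihilate l f) T + annihilate l (annihilate k f) T = 0"
  by (auto simp: annihilate_def slot_sign_insert insert_commute)

text \<open>For k = l only one term survives, depending on whether \<open>T\<close> contains k, and
  its sign occurs twice.\<close>

lemma create_annihilate_anticommute:
  "create k (annihilate l f) T + annihilate l (create k f) T = (if k = l then f T else 0)"
proof (cases "k = l")
  case True
  then show ?thesis
    by (auto simp: create_def annihilate_def slot_sign_insert slot_sign_remove slot_sign_square
        insert_absorb)
next
  case False
  then have "insert l T - {k} = insert l (T - {k})" by auto
  with False show ?thesis
    by (auto simp: create_def annihilate_def slot_sign_insert slot_sign_remove)
qed

section \<open>The Fock action and its descent to the Clifford algebra\<close>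

fun fock_gen :: "generator \<Rightarrow> fock \<Rightarrow> fock" where
  "fock_gen (A n) = (if n < 0 then create else annihilate) (int_encode n)"
| "fock_gen (B n) = (if n < 0 then create else annihilate) (int_encode (- n - 1))"

fun fock_word :: "word \<Rightarrow> fock \<Rightarrow> fock" where
  "fock_word (Word gs) = foldr fock_gen gs"

lemma fock_gen_add: "fock_gen g (\<lambda>T. f T + h T) = (\<lambda>T. fock_gen g f T + fock_gen g h T)"
  by (cases g) (auto simp: create_def annihilate_def distrib_left)

lemma fock_gen_scale: "fock_gen g (\<lambda>T. c * f T) = (\<lambda>T. c * fock_gen g f T)"
  by (cases g) (auto simp: create_def annihilate_def)

lemma fock_word_plus: "fock_word (u + w) f = fock_word u (fock_word w f)"
  by (cases u; cases w) simp

lemma fock_word_add: "fock_word w (\<lambda>T. f T + h T) = (\<lambda>T. fock_word w f T + fock_word w h T)"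
proof (cases w)
  case (Word gs)
  show ?thesis unfolding Word by (induction gs) (simp_all add: fock_gen_add)
qed

lemma fock_word_scale: "fock_word w (\<lambda>T. c * f T) = (\<lambda>T. c * fock_word w f T)"
proof (cases w)
  case (Word gs)
  show ?thesis unfolding Word by (induction gs) (simp_all add: fock_gen_scale)
qed

definition fock_rep :: "free_alg \<Rightarrow> fock \<Rightarrow> fock" where
  "fock_rep x f T = Sum_any (\<lambda>w. Poly_Mapping.lookup x w * fock_word w f T)"

lemma fock_rep_single: "fock_rep (Poly_Mapping.single w c) f = (\<lambda>T. c * fock_word w f T)"
  by (intro ext) (simp add: fock_rep_def lookup_single when_mult)

lemma fock_rep_finite: "finite {w. Poly_Mapping.lookup x w * fock_word w f T \<noteq> 0}"
  by (rule finite_subset[OF _ finite_lookup[of x]]) auto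

lemma fock_rep_add: "fock_rep (x + y) f = (\<lambda>T. fock_rep x f T + fock_rep y f T)"
  by (intro ext) (simp add: fock_rep_def lookup_add distrib_right Sum_any.distrib fock_rep_finite)

lemma fock_rep_add_right: "fock_rep x (\<lambda>T. f T + h T) = (\<lambda>T. fock_rep x f T + fock_rep x h T)"
  by (intro ext) (simp add: fock_rep_def fock_word_add distrib_left Sum_any.distrib fock_rep_finite)

lemma fock_rep_mult: "fock_rep (x * y) f = fock_rep x (fock_rep y f)"
proof (induction x rule: free_alg_induct)
  case (single w c)
  show ?case
  proof (induction y rule: free_alg_induct)
    case (single w' c')
    then show ?case
      by (simp add: mult_single fock_rep_single fock_word_plus fock_word_scale mult.assoc)
  next
    case (add y z)
    then show ?case
      by (simp add: distrib_left fock_rep_add fock_rep_add_right)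
  qed
next
  case (add x z)
  then show ?case by (simp add: distrib_right fock_rep_add)
qed

lemma fock_rep_gen: "fock_rep (free_gen g) f = fock_gen g f"
  by (simp add: free_gen_def fock_rep_single)

lemma fock_rep_0: "fock_rep 0 f = (\<lambda>T. 0)"
  by (intro ext) (simp add: fock_rep_def)

lemma fock_rep_1: "fock_rep 1 f = f"
proof -
  have "fock_word 0 f = f" by (simp add: zero_word_def)
  then show ?thesis using fock_rep_single[of 0 1 f] by simp
qed

lemma fock_rep_0_right: "fock_rep x (\<lambda>T. 0) = (\<lambda>T. 0)"
  using fock_rep_mult[of x 0] by (simp add: fock_rep_0)

lemma fock_rep_minus: "fock_rep (x - y) f = (\<lambda>T. fock_rep x f T - fock_rep y f T)"
  using fock_rep_add[of "x - y" y f] by (simp add: fun_eq_iff)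

text \<open>\<open>A m\<close> and \<open>B n\<close> share a slot exactly if m + n + 1 = 0, and
  then exactly one of m, n is negative: one creates, the other annihilates. Any other pair has
  distinct slots or is of one kind.\<close>

lemma fock_rep_relators:
  assumes "x \<in> clifford_relators"
  shows "fock_rep x f = (\<lambda>T. 0)"
proof -
  have enc: "int_encode m = int_encode n \<longleftrightarrow> m = n" for m n
    using inj_int_encode by (simp add: inj_eq)
  have ac: "annihilate l (create k f) T + create k (annihilate l f) T = (if k = l then f T else 0)"
    for k l T
    using create_annihilate_anticommute[of k l f T] by (simp add: add.commute)
  show ?thesis
    using assms
    by (auto simp: clifford_relators_def fock_rep_add fock_rep_minus fock_rep_mult fock_rep_gen
        fock_rep_0 fock_rep_1 create_anticommute annihilate_anticommute
        create_annihilate_anticommute ac enc fun_eq_iff)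
qed

text \<open>The vector is arbitrary in the induction because in \<open>r * x * t\<close> the factor
  \<open>t\<close> acts first.\<close>

lemma fock_rep_ideal:
  "x \<in> two_sided_ideal clifford_relators \<Longrightarrow> fock_rep x f = (\<lambda>T. 0)"
  by (induction arbitrary: f rule: two_sided_ideal.induct)
    (simp_all add: fock_rep_relators fock_rep_0 fock_rep_add fock_rep_mult fock_rep_0_right)

context
  includes clifford.lifting
begin

lift_definition fock_clifford :: "clifford \<Rightarrow> fock \<Rightarrow> fock" is fock_rep
proof (rule ext)
  fix x y f
  assume "clifford_cong x y"
  then have "fock_rep (x - y) f = (\<lambda>T. 0)"
    unfolding clifford_cong_def by (rule fock_rep_ideal)
  then show "fock_rep x f = fock_rep y f"
    by (simp add: fock_rep_minus fun_eq_iff)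
qed

lemma fock_clifford_mult: "fock_clifford (x * y) f = fock_clifford x (fock_clifford y f)"
  by (induction x rule: clifford.abs_induct, induction y rule: clifford.abs_induct)
    (simp add: times_clifford.abs_eq fock_clifford.abs_eq fock_rep_mult)

lemma fock_clifford_add: "fock_clifford (x + y) f = (\<lambda>T. fock_clifford x f T + fock_clifford y f T)"
  by (induction x rule: clifford.abs_induct, induction y rule: clifford.abs_induct)
    (simp add: plus_clifford.abs_eq fock_clifford.abs_eq fock_rep_add)

lemma fock_clifford_0: "fock_clifford 0 f = (\<lambda>T. 0)"
  by (simp add: zero_clifford.abs_eq fock_clifford.abs_eq fock_rep_0)

lemma fock_clifford_1: "fock_clifford 1 f = f"
  by (simp add: one_clifford.abs_eq fock_clifford.abs_eq fock_rep_1)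

lemma fock_clifford_gen: "fock_clifford (clifford_gen g) f = fock_gen g f"
  by (simp add: clifford_gen.abs_eq fock_clifford.abs_eq fock_rep_gen)

lemma fock_clifford_0_right: "fock_clifford x (\<lambda>T. 0) = (\<lambda>T. 0)"
  using fock_clifford_mult[of x 0] by (simp add: fock_clifford_0)

end

text \<open>\<open>J_plus\<close> kills the Fock vacuum, since its generators annihilate, whereas 1
  fixes it.\<close>

lemma vc_one_neq_0: "vc_one \<noteq> 0"
proof
  define \<Omega> :: fock where "\<Omega> = (\<lambda>T. if T = {} then 1 else 0)"
  have "fock_clifford x \<Omega> = (\<lambda>T. 0)" if "x \<in> J_plus" for x
    using that unfolding J_plus_def
  proof induction
    case (base x)
    then show ?case by (auto simp: fock_clifford_gen annihilate_def \<Omega>_def)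
  qed (simp_all add: fock_clifford_0 fock_clifford_add fock_clifford_mult fock_clifford_0_right)
  moreover assume "vc_one = 0"
  then have "1 \<in> J_plus"
    by transfer (simp add: vc_cong_def)
  ultimately have "\<Omega> {} = 0"
    by (metis fock_clifford_1)
  then show False by (simp add: \<Omega>_def)
qed

section \<open>The module structure, by specialization to the Clifford fields\<close>

theorem proposition4p7:
  fixes P :: "bit \<Rightarrow> vc set"
    and Y :: "vc \<Rightarrow> int \<Rightarrow> vc \<Rightarrow> vc"
    and D :: "vc \<Rightarrow> int \<Rightarrow> vc"
  assumes "vertex_superalgebra vc_scale P vc_one Y"
    and "\<And>n v. Y vc_a n v = vc_act (gen_a n) v"
    and "\<And>n v. Y vc_b n v = vc_act (gen_b n) v"
    and "pseudo_automorphism vc_scale vc_one Y D"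
    and "D vc_a = tensor vc_scale vc_a (fps_to_fls (fps_exp (- 1 / 2)))"
    and "D vc_b = tensor vc_scale vc_b (fps_to_fls (fps_exp (1 / 2)))"
  shows "\<exists>Yt Ys.
    A_tilde_module vc_scale Yt Ys \<and>
    (\<forall>v. field_series Yt v = laurent_ext (field_series (Y vc_a)) (D v)) \<and>
    (\<forall>v. field_series Ys v =
           laurent_ext (field_series (Y vc_b)) (pseudo_inverse vc_scale D v)) \<and>
    vacuum_vector Yt Ys vc_one"
proof -
  interpret complex_vector_space vc_scale ..
  have Y_left: "Vector_Spaces.linear vc_scale vc_scale (\<lambda>u. Y u n v)"
    and Y_right: "Vector_Spaces.linear vc_scale vc_scale (Y u n)"
    and Y_truncated: "\<exists>N. \<forall>n\<ge>N. Y u n v = 0"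
    and Y_vac: "n \<ge> 0 \<Longrightarrow> Y u n vc_one = 0" for u v n
    using assms(1) unfolding vertex_superalgebra_def by (elim conjE, simp)+
  \<comment> \<open>\<open>True\<close> stands for \<open>a\<close> and \<open>False\<close> for
    \<open>b\<close>; the weights are the exponents in the images of \<open>vc_a\<close> and
    \<open>vc_b\<close> under \<open>D\<close>.\<close>
  define F where "F i = (if i then vc_a else vc_b)" for i
  define \<omega> :: "bool \<Rightarrow> complex" where "\<omega> i = (if i then - 1 / 2 else 1 / 2)" for i
  interpret pseudo_weighted_module vc_scale Y F \<omega> vc_one D
  proof
    show "is_field (Y (F i))" for i
      using Y_right Y_truncated by (simp add: is_field_def truncated_def)
    show "W = UNIV" if W: "vc.subspace W" "vc_one \<in> W" "\<And>i n v. v \<in> W \<Longrightarrow> Y (F i) n v \<in> W" for W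
    proof (rule vc_cyclic[OF W(1,2)])
      fix g v
      assume "v \<in> W"
      then show "vc_act (clifford_gen g) v \<in> W"
        using W(3)[of v True] W(3)[of v False] by (cases g) (auto simp: F_def assms(2,3))
    qed
    show "Y (u + w) n v = Y u n v + Y w n v" "Y (vc_scale c u) n v = vc_scale c (Y u n v)"
      for u w n v c
      using Y_left[of n v] by (simp_all add: Vector_Spaces.linear_iff)
    show "pseudo_automorphism vc_scale vc_one Y D" by (rule assms(4))
    show "D (F i) = tensor vc_scale (F i) (fps_to_fls (fps_exp (\<omega> i)))" for i
      by (simp add: F_def \<omega>_def assms(5,6))
  qed
  have F: "F True = vc_a" "F False = vc_b" and \<omega>: "\<omega> True = - 1 / 2" "\<omega> False = 1 / 2"
    by (simp_all add: F_def \<omega>_def)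
  \<comment> \<open>The modes act by left multiplication, so their brackets are the Clifford
    relations.\<close>
  have aa: "Y vc_a m (Y vc_a n v) + Y vc_a n (Y vc_a m v) = 0" for m n v
    by (simp add: assms(2) gen_a_anticommute vc_act_zero flip: vc_act_mult vc_act_add_left)
  have bb: "Y vc_b m (Y vc_b n v) + Y vc_b n (Y vc_b m v) = 0" for m n v
    by (simp add: assms(3) gen_b_anticommute vc_act_zero flip: vc_act_mult vc_act_add_left)
  have ab: "Y vc_a m (Y vc_b n v) + Y vc_b n (Y vc_a m v)
      = vc_scale (if m + n + 1 = 0 then 1 else 0) v" for m n v
    by (simp add: assms(2,3) gen_a_gen_b_anticommute vc_act_zero vc_act_one
        flip: vc_act_mult vc_act_add_left)
  let ?Yt = "dress D (Y vc_a)" and ?Ys = "dress Dinv (Y vc_b)"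
  have fields: "is_field ?Yt" "is_field ?Ys"
    using dress_field[OF D_exponential X_field[of True]]
      dress_field[OF Dinv_exponential X_field[of False]] by (simp_all add: F)
  \<comment> \<open>The values of \<epsilon> come out as -(-1/2 - 1/2) = 1, 1/2 + 1/2 = 1 and -1/2 -
    1/2 = -1.\<close>
  have "A_tilde_module vc_scale ?Yt ?Ys"
    unfolding A_tilde_module_def
    using is_field_linear[OF fields(1)] is_field_linear[OF fields(2)] vc.vector_space_axioms
      D_D_relation[of True True] Dinv_Dinv_relation[of False False] D_Dinv_relation[of True False 1]
      aa bb ab
    by (simp add: F \<omega>)
  moreover have "vacuum_vector ?Yt ?Ys vc_one"
    using dress_D_vac[of True] dress_Dinv_vac[of False] Y_vac vc_one_neq_0
    by (simp add: vacuum_vector_def F)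
  ultimately show ?thesis
    using field_series_dress by blast
qed

end
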